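(* Let $\mathcal I$ be a Borel ideal on $\omega$ such that the forcing $\mathcal P(\omega)/\mathcal I$ does not add reals. Then the forcing $\mathbb M(\mathcal I^+)$ adds a dominating real.
   Context: Ideals on $\omega$ are proper and contain all finite sets; $\mathcal I$ is Borel if it is a Borel subset of $\mathcal P(\omega)\cong 2^\omega$. $\mathcal I^+=\mathcal P(\omega)\setminus\mathcal I$. The forcing $\mathcal P(\omega)/\mathcal I$ is the set of nonzero elements of the quotient Boolean algebra with its Boolean order (equivalently, $\mathcal I^+$ ordered by $\subseteq$); it does not add reals if every element of $\omega^\omega$ in every generic extension belongs to the ground model. For $\mathcal X\subseteq\mathcal P(\omega)$, the Mathias--Prikry forcing $\mathbb M(\mathcal X)$ consists of pairs $(s,A)$ with $s$ a finite subset of $\omega$ and $A\in\mathcal X$, ordered by $(s,A)\le(t,B)$ iff $t\sqsubseteq s$ (i.e. $t=s\cap n$ for some $n\in\omega$), $A\subseteq B$, and $s\setminus t\subseteq B$. A real $d\in\omega^\omega$ is dominating over a model $V$ if for every $f\in\omega^\omega\cap V$, $f(n)<d(n)$ for all but finitely many $n$. A forcing adds a dominating real if every generic extension of the ground model $V$ by it contains a dominating real over $V$. *)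

theory Defs
  imports "HOL-Analysis.Analysis"
begin

section \<open>Reals in generic extensions\<close>

text \<open>
  The universe of HOL plays the role of the ground model. A notion of forcing is a set \<open>P\<close> of
  conditions with a preorder \<open>le\<close>, where \<open>le q p\<close> says that \<open>q\<close> is stronger than \<open>p\<close>.

  A subset of \<open>\<omega> \<times> \<omega>\<close> in a generic extension is the value
  \<open>{(n, m). \<exists>s \<in> G. ((n, m), s) \<in> \<tau>}\<close> of a name \<open>\<tau>\<close> consisting of pairs \<open>((n, m), s)\<close> with \<open>s \<in> P\<close>,
  and every such name has a value. Elements of \<open>\<omega>\<^sup>\<omega>\<close> in the extension are the subsets of
  \<open>\<omega> \<times> \<omega>\<close> in the extension that are graphs of total functions. ``Every generic extension
  satisfies \<open>\<phi>\<close>'' is rendered as ``every condition forces \<open>\<phi>\<close>''.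

  A sentence of the forcing language is identified with the predicate of being a condition that
  forces it. The clauses below are the usual recursive clauses for the forcing relation, with
  negation, conjunction and universal quantification as primitives. Depending on the type of
  the bound variable, a quantifier ranges over natural numbers, over the ground model elements of
  \<open>\<omega>\<^sup>\<omega>\<close> (type \<open>nat \<Rightarrow> nat\<close>), or over names, that is, over the subsets of \<open>\<omega> \<times> \<omega>\<close> in the
  extension.
\<close>

type_synonym 'p name = "((nat \<times> nat) \<times> 'p) set"
type_synonym 'p sentence = "'p \<Rightarrow> bool"

definition preorder_on_conds :: "'p set \<Rightarrow> ('p \<Rightarrow> 'p \<Rightarrow> bool) \<Rightarrow> bool" where
  "preorder_on_conds P le \<longleftrightarrow>
     (\<forall>p\<in>P. le p p) \<and> (\<forall>p\<in>P. \<forall>q\<in>P. \<forall>r\<in>P. le p q \<longrightarrow> le q r \<longrightarrow> le p r)"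

context
  fixes P :: "'p set" and le :: "'p \<Rightarrow> 'p \<Rightarrow> bool"
begin

text \<open>Absolute statements about ground model objects.\<close>

definition f_ground :: "bool \<Rightarrow> 'p sentence" where
  "f_ground b p \<longleftrightarrow> b"

text \<open>\<open>(n, m) \<in> \<tau>\<close>: the conditions deciding this by means of an element of \<open>\<tau>\<close> are dense
  below \<open>p\<close>.\<close>

definition f_mem :: "nat \<Rightarrow> nat \<Rightarrow> 'p name \<Rightarrow> 'p sentence" where
  "f_mem n m \<tau> p \<longleftrightarrow>
     (\<forall>q\<in>P. le q p \<longrightarrow> (\<exists>r\<in>P. le r q \<and> (\<exists>s\<in>P. ((n, m), s) \<in> \<tau> \<and> le r s)))"

definition f_not :: "'p sentence \<Rightarrow> 'p sentence" where
  "f_not \<phi> p \<longleftrightarrow> (\<forall>q\<in>P. le q p \<longrightarrow> \<not> \<phi> q)"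

definition f_and :: "'p sentence \<Rightarrow> 'p sentence \<Rightarrow> 'p sentence" where
  "f_and \<phi> \<psi> p \<longleftrightarrow> \<phi> p \<and> \<psi> p"

definition f_all :: "('a \<Rightarrow> 'p sentence) \<Rightarrow> 'p sentence" where
  "f_all \<Phi> p \<longleftrightarrow> (\<forall>x. \<Phi> x p)"

definition f_imp :: "'p sentence \<Rightarrow> 'p sentence \<Rightarrow> 'p sentence" where
  "f_imp \<phi> \<psi> = f_not (f_and \<phi> (f_not \<psi>))"

definition f_ex :: "('a \<Rightarrow> 'p sentence) \<Rightarrow> 'p sentence" where
  "f_ex \<Phi> = f_not (f_all (\<lambda>x. f_not (\<Phi> x)))"

text \<open>\<open>\<tau> \<in> \<omega>\<^sup>\<omega>\<close>.\<close>

definition f_real :: "'p name \<Rightarrow> 'p sentence" where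
  "f_real \<tau> =
     f_all (\<lambda>n. f_ex (\<lambda>m. f_and (f_mem n m \<tau>)
       (f_all (\<lambda>k. f_imp (f_mem n k \<tau>) (f_ground (k = m))))))"

text \<open>\<open>\<tau> = f\<close>, for \<open>\<tau> \<in> \<omega>\<^sup>\<omega>\<close> and \<open>f\<close> in the ground model.\<close>

definition f_eq_ground :: "'p name \<Rightarrow> (nat \<Rightarrow> nat) \<Rightarrow> 'p sentence" where
  "f_eq_ground \<tau> f = f_all (\<lambda>n. f_mem n (f n) \<tau>)"

text \<open>\<open>f(n) < \<tau>(n)\<close> for all but finitely many \<open>n\<close>.\<close>

definition f_dominates :: "'p name \<Rightarrow> (nat \<Rightarrow> nat) \<Rightarrow> 'p sentence" where
  "f_dominates \<tau> f =
     f_ex (\<lambda>N::nat. f_all (\<lambda>n. f_imp (f_ground (N \<le> n))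
       (f_ex (\<lambda>m. f_and (f_mem n m \<tau>) (f_ground (f n < m))))))"

definition adds_no_reals :: bool where
  "adds_no_reals \<longleftrightarrow>
     (\<forall>p\<in>P. f_all (\<lambda>\<tau>. f_imp (f_real \<tau>) (f_ex (\<lambda>f. f_eq_ground \<tau> f))) p)"

definition adds_dominating_real :: bool where
  "adds_dominating_real \<longleftrightarrow>
     (\<forall>p\<in>P. f_ex (\<lambda>\<tau>. f_and (f_real \<tau>) (f_all (\<lambda>f. f_dominates \<tau> f))) p)"

end

section \<open>Borel ideals on \<open>\<omega>\<close>\<close>

definition ideal_on_omega :: "nat set set \<Rightarrow> bool" where
  "ideal_on_omega I \<longleftrightarrow>
     (\<forall>A\<in>I. \<forall>B\<subseteq>A. B \<in> I) \<and> (\<forall>A\<in>I. \<forall>B\<in>I. A \<union> B \<in> I) \<and>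
     (\<forall>A. finite A \<longrightarrow> A \<in> I) \<and> UNIV \<notin> I"

text \<open>Sets are identified with their characteristic functions; \<open>nat \<Rightarrow> bool\<close> carries the
  product topology of the discrete topology on \<open>bool\<close>.\<close>

definition borel_family :: "nat set set \<Rightarrow> bool" where
  "borel_family X \<longleftrightarrow> {c. {n :: nat. c n} \<in> X} \<in> sets borel"

definition positive_sets :: "nat set set \<Rightarrow> nat set set" where
  "positive_sets I = UNIV - I"

section \<open>The quotient forcing\<close>

definition quotient_rel :: "nat set set \<Rightarrow> (nat set \<times> nat set) set" where
  "quotient_rel I = {(A, B). (A - B) \<union> (B - A) \<in> I}"

definition quotient_conds :: "nat set set \<Rightarrow> nat set set set" where
  "quotient_conds I = (UNIV // quotient_rel I) - {quotient_rel I `` {{}}}"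

definition quotient_le :: "nat set set \<Rightarrow> nat set set \<Rightarrow> nat set set \<Rightarrow> bool" where
  "quotient_le I X Y \<longleftrightarrow> (\<exists>A\<in>X. \<exists>B\<in>Y. A - B \<in> I)"

lemma equiv_quotient_rel:
  assumes "ideal_on_omega I"
  shows "equiv UNIV (quotient_rel I)"
proof (rule equivI)
  show "quotient_rel I \<subseteq> UNIV \<times> UNIV" by simp
  show "refl_on UNIV (quotient_rel I)"
    using assms by (auto simp: refl_on_def quotient_rel_def ideal_on_omega_def)
  show "sym (quotient_rel I)"
    by (auto simp: sym_def quotient_rel_def Un_commute)
  show "trans (quotient_rel I)"
  proof (rule transI)
    fix A B C
    assume "(A, B) \<in> quotient_rel I" "(B, C) \<in> quotient_rel I"
    then have "((A - B) \<union> (B - A)) \<union> ((B - C) \<union> (C - B)) \<in> I"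
      using assms by (simp add: quotient_rel_def ideal_on_omega_def)
    moreover have "(A - C) \<union> (C - A) \<subseteq> ((A - B) \<union> (B - A)) \<union> ((B - C) \<union> (C - B))"
      by blast
    ultimately show "(A, C) \<in> quotient_rel I"
      using assms by (auto simp: quotient_rel_def ideal_on_omega_def)
  qed
qed

lemma quotient_le_class:
  assumes "ideal_on_omega I"
  shows "quotient_le I (quotient_rel I `` {A}) (quotient_rel I `` {B}) \<longleftrightarrow> A - B \<in> I"
proof
  assume "quotient_le I (quotient_rel I `` {A}) (quotient_rel I `` {B})"
  then obtain A' B' where *: "(A - A') \<union> (A' - A) \<in> I" "(B - B') \<union> (B' - B) \<in> I" "A' - B' \<in> I"
    by (auto simp: quotient_le_def quotient_rel_def)
  then have "((A - A') \<union> (A' - A)) \<union> (((B - B') \<union> (B' - B)) \<union> (A' - B')) \<in> I"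
    using assms unfolding ideal_on_omega_def by metis
  moreover have "A - B \<subseteq> ((A - A') \<union> (A' - A)) \<union> (((B - B') \<union> (B' - B)) \<union> (A' - B'))"
    by blast
  ultimately show "A - B \<in> I"
    using assms unfolding ideal_on_omega_def by metis
next
  have "{} \<in> I" using assms by (simp add: ideal_on_omega_def)
  then show "quotient_le I (quotient_rel I `` {A}) (quotient_rel I `` {B})" if "A - B \<in> I"
    unfolding quotient_le_def using that
    by (intro bexI[of _ A] bexI[of _ B]) (auto simp: quotient_rel_def)
qed

lemma quotient_conds_eq:
  assumes "ideal_on_omega I"
  shows "quotient_conds I = (\<lambda>A. quotient_rel I `` {A}) ` positive_sets I"
proof -
  have "quotient_rel I `` {A} = quotient_rel I `` {{}} \<longleftrightarrow> A \<in> I" for A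
    using eq_equiv_class_iff[OF equiv_quotient_rel[OF assms], of A "{}"]
    by (simp add: quotient_rel_def)
  then show ?thesis
    unfolding quotient_conds_def positive_sets_def quotient_def by blast
qed

lemma preorder_quotient:
  assumes "ideal_on_omega I"
  shows "preorder_on_conds (quotient_conds I) (quotient_le I)"
proof -
  have "A - C \<in> I" if "A - B \<in> I" "B - C \<in> I" for A B C
  proof -
    have "(A - B) \<union> (B - C) \<in> I" "A - C \<subseteq> (A - B) \<union> (B - C)"
      using that assms by (auto simp: ideal_on_omega_def)
    then show ?thesis using assms unfolding ideal_on_omega_def by metis
  qed
  moreover have "{} \<in> I" using assms by (simp add: ideal_on_omega_def)
  ultimately show ?thesis
    unfolding preorder_on_conds_def quotient_conds_eq[OF assms]
    by (auto simp: quotient_le_class[OF assms])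
qed

section \<open>Mathias--Prikry forcing\<close>

definition mathias_conds :: "nat set set \<Rightarrow> (nat set \<times> nat set) set" where
  "mathias_conds X = {(s, A). finite s \<and> A \<in> X}"

definition mathias_le :: "nat set \<times> nat set \<Rightarrow> nat set \<times> nat set \<Rightarrow> bool" where
  "mathias_le = (\<lambda>(s, A) (t, B). (\<exists>n. t = s \<inter> {..<n}) \<and> A \<subseteq> B \<and> s - t \<subseteq> B)"

lemma preorder_mathias: "preorder_on_conds (mathias_conds X) mathias_le"
proof -
  have "mathias_le (s, A) (s, A)" if "finite s" for s A
    using that finite_nat_iff_bounded[of s] by (auto simp: mathias_le_def)
  moreover have "mathias_le p r" if "mathias_le p q" "mathias_le q r" for p q r
  proof -
    obtain s A t B u C where e: "p = (s, A)" "q = (t, B)" "r = (u, C)"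
      by (metis surj_pair)
    from that e obtain m n where "t = s \<inter> {..<m}" "u = t \<inter> {..<n}"
      by (auto simp: mathias_le_def)
    then have "u = s \<inter> {..<min m n}" by auto
    then show ?thesis using that e by (auto simp: mathias_le_def)
  qed
  ultimately show ?thesis
    unfolding preorder_on_conds_def mathias_conds_def by blast
qed

end

theory Submission
  imports Defs
begin

text \<open>
  Since \<open>P(\<omega>)/I\<close> adds no reals, countably many dense open sets of \<open>I\<close>-positive sets have a dense
  intersection. Think of the generic ultrafilter \<open>U\<close> it adds. If \<open>U\<close> is not forced to be a P-point,
  then below some positive set there is a decreasing sequence \<open>A n\<close> of elements of \<open>U\<close> without a
  pseudo-intersection, and the next element of \<open>m \<inter> A n\<close> above \<open>n\<close>, for the Mathias real \<open>m\<close>,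
  dominates. If \<open>U\<close> is a P-point, then the analytic ideal \<open>I\<close>, being disjoint from \<open>U\<close>, is
  contained in an \<open>F\<^sub>\<sigma>\<close> set disjoint from \<open>U\<close>; so \<open>I\<close> is \<open>F\<^sub>\<sigma>\<close> below a positive set, that is, a
  countable increasing union of compact families \<open>K n\<close>, which may be chosen hereditary and such that
  unions of two elements of \<open>K n\<close> lie in \<open>K (n + 1)\<close>. Then the least \<open>k\<close> with
  \<open>m \<inter> [n, k] \<notin> K n\<close> dominates.
\<close>

section \<open>Distributivity of the quotient forcing\<close>

lemma ideal_omega_subset: "ideal_on_omega I \<Longrightarrow> A \<in> I \<Longrightarrow> B \<subseteq> A \<Longrightarrow> B \<in> I"
  unfolding ideal_on_omega_def by blast

lemma ideal_omega_Un: "ideal_on_omega I \<Longrightarrow> A \<in> I \<Longrightarrow> B \<in> I \<Longrightarrow> A \<union> B \<in> I"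
  unfolding ideal_on_omega_def by blast

lemma ideal_omega_finite: "ideal_on_omega I \<Longrightarrow> finite A \<Longrightarrow> A \<in> I"
  unfolding ideal_on_omega_def by blast

lemma ideal_omega_subset_Un:
  "ideal_on_omega I \<Longrightarrow> A \<in> I \<Longrightarrow> B \<in> I \<Longrightarrow> C \<subseteq> A \<union> B \<Longrightarrow> C \<in> I"
  by (meson ideal_omega_subset ideal_omega_Un)

lemma ideal_omega_Diff_subset: "ideal_on_omega I \<Longrightarrow> A \<subseteq> B \<Longrightarrow> A - B \<in> I"
  by (metis Diff_eq_empty_iff finite.emptyI ideal_omega_finite)

lemma ideal_omega_Diff_notin:
  "ideal_on_omega I \<Longrightarrow> A \<notin> I \<Longrightarrow> B \<in> I \<Longrightarrow> A - B \<notin> I"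
  using ideal_omega_subset_Un[of I "A - B" B A] by blast

lemma f_imp_iff: "f_imp P le \<phi> \<psi> p \<longleftrightarrow> (\<forall>q\<in>P. le q p \<longrightarrow> \<phi> q \<longrightarrow> (\<exists>r\<in>P. le r q \<and> \<psi> r))"
  by (auto simp: f_imp_def f_not_def f_and_def)

lemma f_ex_iff: "f_ex P le \<Phi> p \<longleftrightarrow> (\<forall>q\<in>P. le q p \<longrightarrow> (\<exists>r\<in>P. le r q \<and> (\<exists>x. \<Phi> x r)))"
  unfolding f_ex_def f_not_def f_all_def by blast

lemma f_mem_in_name:
  assumes "preorder_on_conds P le" "p \<in> P" "s \<in> P" "((n, m), s) \<in> \<tau>" "le p s"
  shows "f_mem P le n m \<tau> p"
  unfolding f_mem_def
proof (intro ballI impI)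
  fix q assume "q \<in> P" "le q p"
  then have "le q q" "le q s" using assms unfolding preorder_on_conds_def by blast+
  then show "\<exists>r\<in>P. le r q \<and> (\<exists>s\<in>P. ((n, m), s) \<in> \<tau> \<and> le r s)"
    using \<open>q \<in> P\<close> assms by blast
qed

text \<open>Totality comes from the density of deciding elements of the name. For uniqueness, a
  condition forcing a second value \<open>k\<close> has an extension below both naming conditions,
  so \<open>k = m\<close>.\<close>

lemma f_real_I:
  assumes pre: "preorder_on_conds P le"
    and dec: "\<And>q n. q \<in> P \<Longrightarrow> le q p \<Longrightarrow> \<exists>r\<in>P. le r q \<and> (\<exists>m. \<exists>s\<in>P. ((n, m), s) \<in> \<tau> \<and> le r s)"
    and uniq: "\<And>q n m k s t. q \<in> P \<Longrightarrow> s \<in> P \<Longrightarrow> t \<in> P \<Longrightarrow> le q s \<Longrightarrow> le q t \<Longrightarrow>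
      ((n, m), s) \<in> \<tau> \<Longrightarrow> ((n, k), t) \<in> \<tau> \<Longrightarrow> k = m"
  shows "f_real P le \<tau> p"
proof -
  have "\<exists>r\<in>P. le r q \<and> (\<exists>m. f_mem P le n m \<tau> r \<and>
      (\<forall>k. f_imp P le (f_mem P le n k \<tau>) (f_ground (k = m)) r))"
    if q: "q \<in> P" "le q p" for q n
  proof -
    obtain r m s where rs: "r \<in> P" "le r q" "s \<in> P" "((n, m), s) \<in> \<tau>" "le r s"
      using dec[OF q, of n] by blast
    have "k = m" if k: "q' \<in> P" "le q' r" "f_mem P le n k \<tau> q'" for k q'
    proof -
      have "le q' q'" using pre k(1) unfolding preorder_on_conds_def by blast
      then obtain r' t where r': "r' \<in> P" "le r' q'" "t \<in> P" "((n, k), t) \<in> \<tau>" "le r' t"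
        using k unfolding f_mem_def by blast
      have "le r' r" using pre r' k rs unfolding preorder_on_conds_def by blast
      then have "le r' s" using pre r' rs unfolding preorder_on_conds_def by blast
      then show ?thesis using uniq r' rs by blast
    qed
    then have "\<forall>k. f_imp P le (f_mem P le n k \<tau>) (f_ground (k = m)) r"
      using pre unfolding f_imp_iff f_ground_def preorder_on_conds_def by blast
    then show ?thesis using f_mem_in_name[OF pre] rs by blast
  qed
  then show ?thesis unfolding f_real_def f_all_def f_ex_iff f_and_def by blast
qed

text \<open>A maximal antichain inside the dense set \<open>D\<close>, by Zorn. If a positive
  \<open>C\<close> met every \<open>w\<close> in a set of \<open>I\<close>, a positive subset of
  \<open>C\<close> in \<open>D\<close> could be added to \<open>W\<close>.\<close>

lemma maximal_almost_disjoint: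
  assumes "ideal_on_omega I"
    and dense: "\<And>C. C \<notin> I \<Longrightarrow> \<exists>B\<subseteq>C. B \<notin> I \<and> B \<in> D"
  obtains W where "W \<subseteq> D" "W \<inter> I = {}"
    "\<And>v w. v \<in> W \<Longrightarrow> w \<in> W \<Longrightarrow> v \<inter> w \<notin> I \<Longrightarrow> v = w"
    "\<And>C. C \<notin> I \<Longrightarrow> \<exists>w\<in>W. C \<inter> w \<notin> I"
proof -
  define \<A> where "\<A> = {W. W \<subseteq> D - I \<and> (\<forall>v\<in>W. \<forall>w\<in>W. v \<inter> w \<notin> I \<longrightarrow> v = w)}"
  have "\<exists>M\<in>\<A>. \<forall>X\<in>\<A>. M \<subseteq> X \<longrightarrow> X = M"
  proof (rule subset_Zorn')
    fix \<C> assume "subset.chain \<A> \<C>"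
    then have ch: "\<C> \<subseteq> \<A>" "\<And>X Y. X \<in> \<C> \<Longrightarrow> Y \<in> \<C> \<Longrightarrow> X \<subseteq> Y \<or> Y \<subseteq> X"
      by (auto simp: subset_chain_def)
    have "v = w" if vw: "v \<in> X" "w \<in> Y" "X \<in> \<C>" "Y \<in> \<C>" "v \<inter> w \<notin> I" for v w X Y
    proof -
      obtain Z where "Z \<in> \<C>" "v \<in> Z" "w \<in> Z" using ch(2) vw by blast
      then show ?thesis using ch(1) vw(5) unfolding \<A>_def by blast
    qed
    moreover have "\<Union>\<C> \<subseteq> D - I" using ch(1) unfolding \<A>_def by blast
    ultimately show "\<Union>\<C> \<in> \<A>" unfolding \<A>_def by auto
  qed
  then obtain W where W: "W \<in> \<A>" and max: "\<And>X. X \<in> \<A> \<Longrightarrow> W \<subseteq> X \<Longrightarrow> X = W" by blast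
  have "\<exists>w\<in>W. C \<inter> w \<notin> I" if "C \<notin> I" for C
  proof (rule ccontr)
    assume neg: "\<not> ?thesis"
    obtain B where B: "B \<subseteq> C" "B \<notin> I" "B \<in> D" using dense \<open>C \<notin> I\<close> by blast
    have disj: "B \<inter> w \<in> I" if "w \<in> W" for w
    proof (rule ideal_omega_subset[OF assms(1)])
      show "C \<inter> w \<in> I" using neg that by blast
    qed (use B in blast)
    then have "insert B W \<in> \<A>" using W B unfolding \<A>_def by (auto simp: Int_commute)
    then have "B \<in> W" using max by blast
    then show False using disj[of B] B by simp
  qed
  moreover have "W \<subseteq> D" "W \<inter> I = {}"
    "v \<in> W \<Longrightarrow> w \<in> W \<Longrightarrow> v \<inter> w \<notin> I \<Longrightarrow> v = w" for v w
    using W unfolding \<A>_def by blast+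
  ultimately show ?thesis by (rule that[rotated -1])
qed

text \<open>Choose a maximal antichain \<open>W n\<close> inside each \<open>D n\<close> and code
  the members selected by the generic filter into one real. A condition deciding this real is
  compatible with only one member of each \<open>W n\<close>, hence almost contained in it.\<close>

lemma adds_no_reals_distributive:
  fixes D :: "nat \<Rightarrow> nat set set"
  assumes id: "ideal_on_omega I"
    and nr: "adds_no_reals (quotient_conds I) (quotient_le I)"
    and dense: "\<And>n C. C \<notin> I \<Longrightarrow> \<exists>B\<subseteq>C. B \<notin> I \<and> B \<in> D n"
    and opn: "\<And>n B C. B \<in> D n \<Longrightarrow> C - B \<in> I \<Longrightarrow> C \<in> D n"
    and A: "A \<notin> I"
  shows "\<exists>B\<subseteq>A. B \<notin> I \<and> (\<forall>n. B \<in> D n)"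
proof -
  let ?P = "quotient_conds I" and ?le = "quotient_le I"
  let ?c = "\<lambda>A. quotient_rel I `` {A}"
  note le = quotient_le_class[OF id]
  \<comment> \<open>Members of a class differ by sets in \<open>I\<close>, so any representative
    tells whether the class is a condition.\<close>
  have cond: "?c A \<in> ?P \<longleftrightarrow> A \<notin> I" for A
  proof -
    have "A \<in> I" if "B \<notin> I" "?c A = ?c B" "A \<in> I" for B
    proof -
      have "B - A \<in> I" using le[of B A] le[of B B] that ideal_omega_finite[OF id] by simp
      then show ?thesis using that ideal_omega_subset_Un[OF id] by blast
    qed
    moreover have "B \<in> I" if "A \<in> I" "?c A = ?c B" for B
    proof -
      have "B - A \<in> I" using le[of B A] le[of B B] that ideal_omega_finite[OF id] by simp
      then show ?thesis using that ideal_omega_subset_Un[OF id, of A "B - A" B] by blast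
    qed
    ultimately show ?thesis
      unfolding quotient_conds_eq[OF id] positive_sets_def by blast
  qed
  have all_cond: "\<exists>A. q = ?c A \<and> A \<notin> I" if "q \<in> ?P" for q
    using that unfolding quotient_conds_eq[OF id] positive_sets_def by blast
  have pre: "preorder_on_conds ?P ?le" by (rule preorder_quotient[OF id])
  have "\<exists>W. W \<subseteq> D n \<and> W \<inter> I = {} \<and> (\<forall>v\<in>W. \<forall>w\<in>W. v \<inter> w \<notin> I \<longrightarrow> v = w)
      \<and> (\<forall>C. C \<notin> I \<longrightarrow> (\<exists>w\<in>W. C \<inter> w \<notin> I))" for n
    using maximal_almost_disjoint[OF id dense[where n = n]] by metis
  then obtain W where W: "\<And>n. W n \<subseteq> D n" "\<And>n. W n \<inter> I = {}"
    and ad: "\<And>n v w. v \<in> W n \<Longrightarrow> w \<in> W n \<Longrightarrow> v \<inter> w \<notin> I \<Longrightarrow> v = w"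
    and max: "\<And>n C. C \<notin> I \<Longrightarrow> \<exists>w\<in>W n. C \<inter> w \<notin> I"
    by metis
  \<comment> \<open>The value at \<open>prod_encode (n, k)\<close> is the characteristic function,
    at \<open>k\<close>, of the member of \<open>W n\<close> lying in the generic filter.\<close>
  define \<tau> where "\<tau> = {((prod_encode (n, k), m), ?c w) | n k m w. w \<in> W n \<and> m = (if k \<in> w then 1 else 0 :: nat)}"
  have same: "v = w" if "v \<in> W n" "w \<in> W n" "Q \<notin> I" "Q - v \<in> I" "Q - w \<in> I" for v w n Q
  proof -
    have "v \<inter> w \<notin> I"
      using ideal_omega_subset_Un[OF id, of "(Q - v) \<union> (Q - w)" "v \<inter> w" Q]
        ideal_omega_Un[OF id] that by blast
    then show ?thesis using ad that by blast
  qed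
  have real: "f_real ?P ?le \<tau> (?c A)"
  proof (rule f_real_I[OF pre])
    fix q N assume "q \<in> ?P"
    then obtain Q where Q: "q = ?c Q" "Q \<notin> I" using all_cond by blast
    obtain n k where N: "N = prod_encode (n, k)" by (metis prod_decode_inverse surj_pair)
    obtain w where w: "w \<in> W n" "Q \<inter> w \<notin> I" using max Q by blast
    have "((N, if k \<in> w then 1 else 0), ?c w) \<in> \<tau>" unfolding \<tau>_def N using w by blast
    moreover have "?le (?c (Q \<inter> w)) q" "?le (?c (Q \<inter> w)) (?c w)"
      unfolding Q le using ideal_omega_finite[OF id, of "{}"] by (auto simp: Int_Diff)
    moreover have "?c (Q \<inter> w) \<in> ?P" "?c w \<in> ?P" using cond w W by blast+
    ultimately show "\<exists>r\<in>?P. ?le r q \<and> (\<exists>m. \<exists>s\<in>?P. ((N, m), s) \<in> \<tau> \<and> ?le r s)" by blast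
  next
    fix q N m k s t
    assume h: "q \<in> ?P" "?le q s" "?le q t" "((N, m), s) \<in> \<tau>" "((N, k), t) \<in> \<tau>"
    obtain Q where Q: "q = ?c Q" "Q \<notin> I" using all_cond h by blast
    obtain n i w where w: "N = prod_encode (n, i)" "s = ?c w" "w \<in> W n" "m = (if i \<in> w then 1 else 0)"
      using h unfolding \<tau>_def by blast
    obtain n' i' v where v: "N = prod_encode (n', i')" "t = ?c v" "v \<in> W n'" "k = (if i' \<in> v then 1 else 0)"
      using h unfolding \<tau>_def by blast
    have "n' = n" "i' = i" using w v by (simp_all add: prod_encode_eq)
    then show "k = m" using same[of w n v Q] h w v Q le by simp
  qed
  have "?c A \<in> ?P" using cond A by blast
  moreover have "?le (?c A) (?c A)" using le ideal_omega_finite[OF id] by simp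
  ultimately obtain q f where q: "q \<in> ?P" "?le q (?c A)" "f_eq_ground ?P ?le \<tau> f q"
    using nr real pre
    unfolding adds_no_reals_def f_all_def f_imp_iff f_ex_iff preorder_on_conds_def by metis
  obtain B where B: "q = ?c B" "B \<notin> I" using all_cond q by blast
  have BA: "B - A \<in> I" using q B le by simp
  \<comment> \<open>Every member of \<open>W n\<close> compatible with \<open>B\<close> is decoded
    from the same ground model \<open>f\<close>; hence there is only one.\<close>
  have meet: "w = {k. f (prod_encode (n, k)) = 1}" if "w \<in> W n" "B \<inter> w \<notin> I" for n w
  proof -
    have "f (prod_encode (n, k)) = (if k \<in> w then 1 else 0)" for k
    proof -
      have "f_mem ?P ?le (prod_encode (n, k)) (f (prod_encode (n, k))) \<tau> q"
        using q unfolding f_eq_ground_def f_all_def by blast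
      moreover have "?c (B \<inter> w) \<in> ?P" "?le (?c (B \<inter> w)) q"
        using cond that le B ideal_omega_finite[OF id, of "{}"] by (auto simp: Int_Diff)
      ultimately obtain r s where r: "r \<in> ?P" "?le r (?c (B \<inter> w))" "?le r s"
        "((prod_encode (n, k), f (prod_encode (n, k))), s) \<in> \<tau>"
        unfolding f_mem_def by blast
      obtain R where R: "r = ?c R" "R \<notin> I" using all_cond r by blast
      obtain v where v: "s = ?c v" "v \<in> W n" "f (prod_encode (n, k)) = (if k \<in> v then 1 else 0)"
        using r(4) unfolding \<tau>_def by (auto simp: prod_encode_eq)
      have "R - (B \<inter> w) \<in> I" using r R le by simp
      then have "R - w \<in> I" using ideal_omega_subset[OF id] by blast
      then have "v = w" using same[of v n w R] v that r R le by simp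
      then show ?thesis using v by simp
    qed
    then show ?thesis by auto
  qed
  \<comment> \<open>\<open>B\<close> is below \<open>A\<close> only modulo \<open>I\<close>; cutting
    to \<open>B \<inter> A\<close> gives a literal subset.\<close>
  have "B \<inter> A \<in> D n" for n
  proof -
    obtain w where w: "w \<in> W n" "B \<inter> w \<notin> I" using max B by blast
    have "B - w \<in> I"
    proof (rule ccontr)
      assume neg: "B - w \<notin> I"
      then obtain v where v: "v \<in> W n" "(B - w) \<inter> v \<notin> I" using max by blast
      have "v \<noteq> w" using v ideal_omega_finite[OF id, of "{}"] by (auto simp: Int_commute)
      have "B \<inter> v \<notin> I" using v ideal_omega_subset[OF id, of "B \<inter> v" "(B - w) \<inter> v"] by blast
      then show False using meet w v \<open>v \<noteq> w\<close> by metis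
    qed
    then have "B \<inter> A - w \<in> I" by (rule ideal_omega_subset[OF id]) blast
    then show ?thesis using opn w W by blast
  qed
  moreover have "B \<inter> A \<notin> I"
    using ideal_omega_subset_Un[OF id BA, of "B \<inter> A" B] B by blast
  ultimately show ?thesis by (intro exI[of _ "B \<inter> A"]) auto
qed

text \<open>Enlarge each \<open>D n\<close> by the sets almost disjoint from \<open>A\<close> and
  apply the global version; a positive subset of \<open>A\<close> is never of the added
  kind.\<close>

lemma adds_no_reals_distributive_below:
  fixes D :: "nat \<Rightarrow> nat set set"
  assumes id: "ideal_on_omega I"
    and nr: "adds_no_reals (quotient_conds I) (quotient_le I)"
    and A: "A \<notin> I"
    and dense: "\<And>n C. C \<subseteq> A \<Longrightarrow> C \<notin> I \<Longrightarrow> \<exists>B\<subseteq>C. B \<notin> I \<and> B \<in> D n"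
    and opn: "\<And>n B C. B \<in> D n \<Longrightarrow> C - B \<in> I \<Longrightarrow> C \<in> D n"
  shows "\<exists>B\<subseteq>A. B \<notin> I \<and> (\<forall>n. B \<in> D n)"
proof -
  have "\<exists>B\<subseteq>A. B \<notin> I \<and> (\<forall>n. B \<in> D n \<union> {C. C \<inter> A \<in> I})"
  proof (rule adds_no_reals_distributive[OF id nr _ _ A])
    show "\<exists>B\<subseteq>C. B \<notin> I \<and> B \<in> D n \<union> {C. C \<inter> A \<in> I}" if "C \<notin> I" for n C
      using dense[of "C \<inter> A" n] that by (cases "C \<inter> A \<in> I") auto
    show "C \<in> D n \<union> {C. C \<inter> A \<in> I}" if "B \<in> D n \<union> {C. C \<inter> A \<in> I}" "C - B \<in> I" for n B C
      using that opn ideal_omega_subset_Un[OF id, of "B \<inter> A" "C - B" "C \<inter> A"] by blast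
  qed
  then obtain B where B: "B \<subseteq> A" "B \<notin> I" "\<forall>n. B \<in> D n \<union> {C. C \<inter> A \<in> I}" by blast
  then have "B \<inter> A = B" by blast
  then show ?thesis using B by auto
qed

section \<open>Dominating Mathias--Prikry reals\<close>

text \<open>The first clause lets the Mathias real catch a member of \<open>X n\<close> from any
  stem; the second lets a condition delay this past \<open>f n\<close> for almost all
  \<open>n\<close>.\<close>

definition dominating_family :: "nat set set \<Rightarrow> nat set \<Rightarrow> (nat \<Rightarrow> nat set set) \<Rightarrow> bool" where
  "dominating_family I B X \<longleftrightarrow>
     (\<forall>C n k. C \<subseteq> B \<longrightarrow> C \<notin> I \<longrightarrow> (\<exists>x\<in>X n. finite x \<and> x \<subseteq> C - {..<k})) \<and>
     (\<forall>f::nat \<Rightarrow> nat. \<forall>C\<subseteq>B. C \<notin> I \<longrightarrow>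
       (\<exists>D\<subseteq>C. D \<notin> I \<and> (\<exists>N. \<forall>n\<ge>N. \<forall>x\<in>X n. \<not> x \<subseteq> D \<inter> {..f n})))"

lemma adds_dominating_real_I:
  assumes "\<And>p. p \<in> P \<Longrightarrow>
    \<exists>r\<in>P. le r p \<and> (\<exists>\<tau>. f_real P le \<tau> r \<and> (\<forall>f. f_dominates P le \<tau> f r))"
  shows "adds_dominating_real P le"
  using assms unfolding adds_dominating_real_def f_ex_iff f_and_def f_all_def by blast

lemma f_dominates_I:
  assumes pre: "preorder_on_conds P le" and p: "p \<in> P"
    and dom: "\<And>q. q \<in> P \<Longrightarrow> le q p \<Longrightarrow> \<exists>r\<in>P. le r q \<and> (\<exists>N::nat. \<forall>n\<ge>N. \<forall>q'\<in>P. le q' r \<longrightarrow>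
      (\<exists>r'\<in>P. le r' q' \<and> (\<exists>m. \<exists>s\<in>P. ((n, m), s) \<in> \<tau> \<and> le r' s \<and> f n < m)))"
  shows "f_dominates P le \<tau> f p"
proof -
  have refl: "\<And>p. p \<in> P \<Longrightarrow> le p p"
    and trans: "\<And>p q r. p \<in> P \<Longrightarrow> q \<in> P \<Longrightarrow> r \<in> P \<Longrightarrow> le p q \<Longrightarrow> le q r \<Longrightarrow> le p r"
    using pre unfolding preorder_on_conds_def by blast+
  have "\<exists>r\<in>P. le r q \<and> (\<exists>N::nat. \<forall>n. f_imp P le (f_ground (N \<le> n))
       (f_ex P le (\<lambda>m. f_and (f_mem P le n m \<tau>) (f_ground (f n < m)))) r)"
    if q: "q \<in> P" "le q p" for q
  proof -
    obtain r N where r: "r \<in> P" "le r q" and N: "\<And>n q'. N \<le> n \<Longrightarrow> q' \<in> P \<Longrightarrow> le q' r \<Longrightarrow>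
        \<exists>r'\<in>P. le r' q' \<and> (\<exists>m. \<exists>s\<in>P. ((n, m), s) \<in> \<tau> \<and> le r' s \<and> f n < m)"
      using dom[OF q] by metis
    have "f_ex P le (\<lambda>m. f_and (f_mem P le n m \<tau>) (f_ground (f n < m))) q'"
      if n: "N \<le> n" "q' \<in> P" "le q' r" for n q'
      unfolding f_ex_iff f_and_def f_ground_def
    proof (intro ballI impI)
      fix q'' assume q'': "q'' \<in> P" "le q'' q'"
      then have "le q'' r" using trans n r by blast
      then obtain r' m s where "r' \<in> P" "le r' q''" "s \<in> P" "((n, m), s) \<in> \<tau>" "le r' s" "f n < m"
        using N n q'' by blast
      then show "\<exists>r\<in>P. le r q'' \<and> (\<exists>m. f_mem P le n m \<tau> r \<and> f n < m)"
        using f_mem_in_name[OF pre] by blast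
    qed
    then have "f_imp P le (f_ground (N \<le> n))
       (f_ex P le (\<lambda>m. f_and (f_mem P le n m \<tau>) (f_ground (f n < m)))) r" for n
      unfolding f_imp_iff f_ground_def using refl by blast
    then show ?thesis using r by blast
  qed
  then show ?thesis
    unfolding f_dominates_def f_ex_iff[of P le _ p] f_all_def by blast
qed

text \<open>The name below denotes \<open>n \<mapsto> LEAST k. reaches X n k m\<close>, where \<open>m\<close> is the generic real.
  Requiring \<open>k \<in> t\<close> makes the value invariant under end-extensions of the stem.\<close>

definition reaches :: "(nat \<Rightarrow> nat set set) \<Rightarrow> nat \<Rightarrow> nat \<Rightarrow> nat set \<Rightarrow> bool" where
  "reaches X n k t \<longleftrightarrow> k \<in> t \<and> (\<exists>x\<in>X n. x \<subseteq> t \<inter> {n..k})"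

definition reaching_name ::
    "(nat \<Rightarrow> nat set set) \<Rightarrow> (nat set \<times> nat set) name" where
  "reaching_name X = {((n, m), (t, C)) | n m t C. reaches X n m t \<and> (\<forall>j<m. \<not> reaches X n j t)}"

text \<open>From \<open>k \<in> t\<close> it follows that \<open>k < i\<close>, so \<open>t\<close>
  and \<open>t'\<close> agree up to \<open>k\<close>: extending a stem never changes a value already
  reached.\<close>

lemma reaches_initial_segment:
  assumes "k \<in> t" "t = t' \<inter> {..<i}" "j \<le> k"
  shows "reaches X n j t' \<longleftrightarrow> reaches X n j t"
proof -
  have "t' \<inter> {..k} = t \<inter> {..k}" using assms by auto
  moreover have "j \<in> u \<longleftrightarrow> j \<in> u \<inter> {..k}" "u \<inter> {n..j} = (u \<inter> {..k}) \<inter> {n..j}" for u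
    using assms(3) by auto
  ultimately have "j \<in> t' \<longleftrightarrow> j \<in> t" "t' \<inter> {n..j} = t \<inter> {n..j}"
    by metis+
  then show ?thesis unfolding reaches_def by simp
qed

text \<open>Append to the stem a member \<open>x\<close> of \<open>X n\<close> far out in
  \<open>C\<close>, then a point \<open>k\<close> of \<open>C\<close> above it. This
  \<open>k\<close> is reached, so a least reached number exists.\<close>

lemma reaching_name_extend:
  assumes id: "ideal_on_omega I"
    and X: "\<And>C k. C \<subseteq> B \<Longrightarrow> C \<notin> I \<Longrightarrow> \<exists>x\<in>X n. finite x \<and> x \<subseteq> C - {..<k}"
    and t: "finite t" and C: "C \<subseteq> B" "C \<notin> I"
  shows "\<exists>t' m. mathias_le (t', C) (t, C) \<and> finite t' \<and> ((n, m), (t', C)) \<in> reaching_name X"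
proof -
  obtain i where i: "t \<subseteq> {..<i}" using t by (auto simp: finite_nat_iff_bounded)
  obtain x where x: "x \<in> X n" "finite x" "x \<subseteq> C - {..<max i n}" using X C by blast
  obtain l where l: "x \<subseteq> {..<l}" using x by (auto simp: finite_nat_iff_bounded)
  have "infinite C" using C ideal_omega_finite[OF id] by blast
  \<comment> \<open>\<open>k\<close> is at least \<open>l\<close>, so \<open>{n..k}\<close> contains
    \<open>x\<close>; as \<open>x\<close> and \<open>k\<close> lie at or above \<open>i\<close>,
    \<open>t\<close> remains an initial segment.\<close>
  then obtain k where k: "k \<in> C" "max i (max n l) \<le> k" by (metis infinite_nat_iff_unbounded_le)
  let ?t' = "t \<union> x \<union> {k}"
  have "reaches X n k ?t'"
    unfolding reaches_def using x l k by (intro conjI bexI[of _ x]) (auto simp: subset_iff not_less)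
  then have "\<exists>m. reaches X n m ?t' \<and> (\<forall>j<m. \<not> reaches X n j ?t')"
    using exists_least_iff[of "\<lambda>m. reaches X n m ?t'"] by blast
  moreover have "t = ?t' \<inter> {..<i}" using i x k by (auto simp: subset_iff not_less)
  then have "mathias_le (?t', C) (t, C)"
    unfolding mathias_le_def using x k by auto
  ultimately show ?thesis using t x unfolding reaching_name_def by blast
qed

text \<open>After shrinking the reservoir to \<open>B\<close>, \<open>reaching_name X\<close> names
  a real; thinning the reservoir further to a \<open>D\<close> sparse with respect to
  \<open>f\<close> pushes its value above \<open>f n\<close>.\<close>

lemma mathias_adds_dominating_real:
  assumes id: "ideal_on_omega I"
    and ex: "\<And>A. A \<notin> I \<Longrightarrow> \<exists>B X. B \<subseteq> A \<and> B \<notin> I \<and> dominating_family I B X"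
  shows "adds_dominating_real (mathias_conds (positive_sets I)) mathias_le"
proof (rule adds_dominating_real_I)
  let ?P = "mathias_conds (positive_sets I)"
  have cond: "(t, C) \<in> ?P \<longleftrightarrow> finite t \<and> C \<notin> I" for t C
    by (simp add: mathias_conds_def positive_sets_def)
  note pre = preorder_mathias[of "positive_sets I"]
  have refl: "\<And>p. p \<in> ?P \<Longrightarrow> mathias_le p p"
    and trans: "\<And>p q r. p \<in> ?P \<Longrightarrow> q \<in> ?P \<Longrightarrow> r \<in> ?P \<Longrightarrow>
      mathias_le p q \<Longrightarrow> mathias_le q r \<Longrightarrow> mathias_le p r"
    using pre unfolding preorder_on_conds_def by blast+
  fix p assume p: "p \<in> ?P"
  obtain s A where sA: "p = (s, A)" by (metis surj_pair)
  have A: "finite s" "A \<notin> I" using p sA cond by auto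
  obtain B X where B: "B \<subseteq> A" "B \<notin> I" and dom: "dominating_family I B X"
    using ex[OF A(2)] by blast
  have X: "\<exists>x\<in>X n. finite x \<and> x \<subseteq> C - {..<k}" if "C \<subseteq> B" "C \<notin> I" for C n k
    using dom that unfolding dominating_family_def by blast
  have sparse: "\<exists>D\<subseteq>C. D \<notin> I \<and> (\<exists>N. \<forall>n\<ge>N. \<forall>x\<in>X n. \<not> x \<subseteq> D \<inter> {..f n})"
    if "C \<subseteq> B" "C \<notin> I" for f C
    using dom that unfolding dominating_family_def by blast
  let ?r = "(s, B)" and ?\<tau> = "reaching_name X"
  \<comment> \<open>Reflexivity at \<open>(t, UNIV)\<close>, a condition because \<open>I\<close> is
    proper, yields the \<open>n\<close> with \<open>t = t \<inter> {..<n}\<close>.\<close>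
  have shrink: "mathias_le (t, D) (t, C)" if "finite t" "D \<subseteq> C" for t C D
    using refl[of "(t, UNIV)"] that id unfolding cond mathias_le_def ideal_on_omega_def by auto
  have r: "?r \<in> ?P" "mathias_le ?r p" using cond A B sA shrink by auto
  have decide: "\<exists>t' m. (t', C) \<in> ?P \<and> mathias_le (t', C) (t, C) \<and> ((n, m), (t', C)) \<in> ?\<tau>"
    if "(t, C) \<in> ?P" "mathias_le (t, C) ?r" for t C n
    using reaching_name_extend[OF id X, where t = t and C = C and n = n] that cond unfolding mathias_le_def by fastforce
  have "f_real ?P mathias_le ?\<tau> ?r"
  proof (rule f_real_I[OF pre])
    fix q n assume q: "q \<in> ?P" "mathias_le q ?r"
    obtain t C where "q = (t, C)" by (metis surj_pair)
    then show "\<exists>r\<in>?P. mathias_le r q \<and> (\<exists>m. \<exists>s\<in>?P. ((n, m), s) \<in> ?\<tau> \<and> mathias_le r s)"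
      using decide[of t C n] q refl by metis
  next
    fix q n m k u v
    assume h: "mathias_le q u" "mathias_le q v" "((n, m), u) \<in> ?\<tau>" "((n, k), v) \<in> ?\<tau>"
    obtain tq Cq t C t' C' where e: "q = (tq, Cq)" "u = (t, C)" "v = (t', C')" by (metis surj_pair)
    obtain i i' where i: "t = tq \<inter> {..<i}" "t' = tq \<inter> {..<i'}"
      using h e unfolding mathias_le_def by auto
    have m: "reaches X n m t" "\<forall>j<m. \<not> reaches X n j t"
      and k: "reaches X n k t'" "\<forall>j<k. \<not> reaches X n j t'"
      using h e unfolding reaching_name_def by auto
    \<comment> \<open>The least reached numbers of \<open>t\<close> and of \<open>t'\<close> are
      both least for the common end-extension \<open>tq\<close>.\<close>
    have "m \<in> t" "k \<in> t'" using m k unfolding reaches_def by auto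
    then have "reaches X n m tq \<and> (\<forall>j<m. \<not> reaches X n j tq)"
      "reaches X n k tq \<and> (\<forall>j<k. \<not> reaches X n j tq)"
      using m k reaches_initial_segment[OF _ i(1)] reaches_initial_segment[OF _ i(2)] by auto
    then show "k = m" by (meson linorder_neqE_nat)
  qed
  moreover have "f_dominates ?P mathias_le ?\<tau> f ?r" for f
  proof (rule f_dominates_I[OF pre r(1)])
    fix q assume q: "q \<in> ?P" "mathias_le q ?r"
    obtain t C where tC: "q = (t, C)" by (metis surj_pair)
    have C: "finite t" "C \<notin> I" "C \<subseteq> B" using q tC cond unfolding mathias_le_def by auto
    obtain D where D: "D \<subseteq> C" "D \<notin> I" and "\<exists>N. \<forall>n\<ge>N. \<forall>x\<in>X n. \<not> x \<subseteq> D \<inter> {..f n}"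
      using sparse[OF C(3,2), of f] by blast
    then obtain N where N: "\<And>n x. n \<ge> N \<Longrightarrow> x \<in> X n \<Longrightarrow> \<not> x \<subseteq> D \<inter> {..f n}" by blast
    obtain i where i: "t \<subseteq> {..<i}" using C by (auto simp: finite_nat_iff_bounded)
    have D': "(t, D) \<in> ?P" "mathias_le (t, D) q" using cond C D tC shrink by auto
    have "\<exists>r'\<in>?P. mathias_le r' q' \<and> (\<exists>m. \<exists>s\<in>?P. ((n, m), s) \<in> ?\<tau> \<and> mathias_le r' s \<and> f n < m)"
      if n: "n \<ge> max N i" and q': "q' \<in> ?P" "mathias_le q' (t, D)" for n q'
    proof -
      obtain u E where uE: "q' = (u, E)" by (metis surj_pair)
      have "mathias_le q' ?r" using trans q' D' q r by blast
      then obtain u' m where u': "(u', E) \<in> ?P" "mathias_le (u', E) q'" "((n, m), (u', E)) \<in> ?\<tau>"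
        using decide[of u E n] q' uE by blast
      have "mathias_le (u', E) (t, D)" using trans u' q' D' by blast
      then have "u' - t \<subseteq> D" unfolding mathias_le_def by auto
      obtain x where x: "x \<in> X n" "x \<subseteq> u' \<inter> {n..m}"
        using u'(3) unfolding reaching_name_def reaches_def by auto
      \<comment> \<open>As \<open>n \<ge> i\<close>, the block \<open>x\<close> lies past the stem
        \<open>t\<close>, so all its points were drawn from \<open>D\<close>.\<close>
      have "x \<subseteq> D \<inter> {..m}" using x(2) \<open>u' - t \<subseteq> D\<close> i n by fastforce
      then have "f n < m" using N[of n x] x n by (cases "f n < m") auto
      then show ?thesis using u' refl by blast
    qed
    then show "\<exists>r\<in>?P. mathias_le r q \<and> (\<exists>N::nat. \<forall>n\<ge>N. \<forall>q'\<in>?P. mathias_le q' r \<longrightarrow>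
      (\<exists>r'\<in>?P. mathias_le r' q' \<and> (\<exists>m. \<exists>s\<in>?P. ((n, m), s) \<in> ?\<tau> \<and> mathias_le r' s \<and> f n < m)))"
      using D' by blast
  qed
  ultimately show "\<exists>r\<in>?P. mathias_le r p \<and>
      (\<exists>\<tau>. f_real ?P mathias_le \<tau> r \<and> (\<forall>f. f_dominates ?P mathias_le \<tau> f r))"
    using r by blast
qed

section \<open>Failure of the P-point property, and \<open>F\<^sub>\<sigma>\<close> ideals\<close>

text \<open>\<open>X n\<close> consists of the singletons from a decreasing version
  \<open>A'\<close> of the sequence. The points of \<open>C \<inter> A' n\<close> up to
  \<open>f n\<close>, collected over all \<open>n\<close>, form a pseudo-intersection, hence a set
  in \<open>I\<close> that can be removed from \<open>C\<close>.\<close>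

lemma dominating_family_non_p_point:
  fixes A :: "nat \<Rightarrow> nat set"
  assumes id: "ideal_on_omega I"
    and A: "\<And>n. B - A n \<in> I"
    and no_pseudo: "\<And>C. C \<subseteq> B \<Longrightarrow> (\<And>n. finite (C - A n)) \<Longrightarrow> C \<in> I"
  shows "\<exists>X. dominating_family I B X"
proof -
  define A' where "A' n = B \<inter> (\<Inter>i\<le>n. A i)" for n :: nat
  have A': "B - A' n \<in> I" for n
  proof (induction n)
    case 0
    then show ?case using A[of 0] by (auto simp: A'_def Diff_Int)
  next
    case (Suc n)
    have "B - A' (Suc n) \<subseteq> (B - A' n) \<union> (B - A (Suc n))"
      by (auto simp: A'_def le_Suc_eq)
    then show ?case using ideal_omega_subset_Un[OF id Suc A] by blast
  qed
  have mono: "A' n \<subseteq> A' m" if "m \<le> n" for m n using that by (auto simp: A'_def)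
  define X where "X n = (\<lambda>k. {k}) ` A' n" for n
  have "\<exists>x\<in>X n. finite x \<and> x \<subseteq> C - {..<k}" if C: "C \<subseteq> B" "C \<notin> I" for C n k
  proof -
    have "(B - A' n) \<union> {..<k} \<in> I" using ideal_omega_Un[OF id A'] ideal_omega_finite[OF id] by blast
    then have "C - ((B - A' n) \<union> {..<k}) \<notin> I" using ideal_omega_Diff_notin[OF id] C by blast
    then have "C - ((B - A' n) \<union> {..<k}) \<noteq> {}" using ideal_omega_finite[OF id] finite.emptyI by metis
    then obtain i where "i \<in> A' n" "i \<in> C - {..<k}" using C by auto
    then show ?thesis unfolding X_def by auto
  qed
  moreover have "\<exists>D\<subseteq>C. D \<notin> I \<and> (\<exists>N. \<forall>n\<ge>N. \<forall>x\<in>X n. \<not> x \<subseteq> D \<inter> {..f n})"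
    if C: "C \<subseteq> B" "C \<notin> I" for f :: "nat \<Rightarrow> nat" and C
  proof -
    define E where "E = (\<Union>n. C \<inter> A' n \<inter> {..f n})"
    \<comment> \<open>A point put into \<open>E\<close> by a stage \<open>i \<ge> n\<close> lies in
      \<open>A' i \<subseteq> A' n\<close>; so only the stages below \<open>n\<close> contribute,
      each with finitely many points.\<close>
    have "E - A' n \<subseteq> (\<Union>i<n. {..f i})" for n
    proof
      fix x assume x: "x \<in> E - A' n"
      then obtain i where i: "x \<in> A' i" "x \<le> f i" unfolding E_def by blast
      then have "i < n" using x mono[of n i] by (cases "i < n") auto
      then show "x \<in> (\<Union>i<n. {..f i})" using i by blast
    qed
    then have "finite (E - A' n)" for n by (rule finite_subset) auto
    then have "finite (E - A n)" for n by (rule rev_finite_subset) (auto simp: A'_def)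
    then have "E \<in> I" using no_pseudo[of E] C unfolding E_def by blast
    then have "C - E \<notin> I" using ideal_omega_Diff_notin[OF id] C by blast
    moreover have "\<not> x \<subseteq> (C - E) \<inter> {..f n}" if "x \<in> X n" for x n
      using that unfolding X_def E_def by auto
    ultimately show ?thesis by (intro exI[of _ "C - E"]) auto
  qed
  ultimately have "dominating_family I B X" unfolding dominating_family_def by simp
  then show ?thesis by blast
qed

text \<open>A hereditary closed, hence compact, subset of the Cantor space, presented by conditions
  on finite subsets.\<close>

definition compact_family :: "nat set set \<Rightarrow> nat set set" where
  "compact_family F = {D. \<forall>a\<subseteq>D. finite a \<longrightarrow> a \<in> F}"

lemma compact_family_subset: "D \<in> compact_family F \<Longrightarrow> E \<subseteq> D \<Longrightarrow> E \<in> compact_family F"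
  unfolding compact_family_def by blast

text \<open>If finite \<open>a\<close> and \<open>b\<close> witnessed failure for \<open>F\<close>
  and for \<open>G\<close>, then by heredity \<open>a \<union> b\<close> would witness failure for
  \<open>F \<union> G\<close>.\<close>

lemma compact_family_Un:
  assumes "D \<in> compact_family (F \<union> G)"
    and "\<And>a b. a \<in> F \<Longrightarrow> b \<subseteq> a \<Longrightarrow> b \<in> F" "\<And>a b. a \<in> G \<Longrightarrow> b \<subseteq> a \<Longrightarrow> b \<in> G"
  shows "D \<in> compact_family F \<or> D \<in> compact_family G"
proof (rule ccontr)
  assume "\<not> ?thesis"
  then obtain a b where ab: "a \<subseteq> D" "finite a" "a \<notin> F" "b \<subseteq> D" "finite b" "b \<notin> G"
    unfolding compact_family_def by blast
  then have "a \<union> b \<in> F \<union> G" using assms(1) unfolding compact_family_def by simp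
  then show False using assms(2)[of "a \<union> b" a] assms(3)[of "a \<union> b" b] ab by auto
qed

lemma compact_family_splits:
  assumes her: "\<And>a b. a \<in> F \<Longrightarrow> b \<subseteq> a \<Longrightarrow> b \<in> F"
    and D: "D \<in> compact_family {a \<union> b | a b. a \<in> F \<and> b \<in> F}"
  shows "\<exists>a b. D = a \<union> b \<and> a \<in> compact_family F \<and> b \<in> compact_family F"
proof -
  \<comment> \<open>Koenig's lemma; as \<open>F\<close> is hereditary, the second part may be taken to be \<open>D - a\<close>.\<close>
  define S where "S m a \<longleftrightarrow> a \<in> F \<and> a \<subseteq> D \<inter> {..<m} \<and> D \<inter> {..<m} - a \<in> F" for m a
  have S_restrict: "S m' (a \<inter> {..<m'})" if a: "S m a" "m' \<le> m" for m m' a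
  proof -
    have "D \<inter> {..<m'} - a \<inter> {..<m'} \<subseteq> D \<inter> {..<m} - a" using a by auto
    then show ?thesis using a her unfolding S_def by blast
  qed
  have ex: "\<exists>a. S m a" for m
  proof -
    have "D \<inter> {..<m} \<in> {a \<union> b | a b. a \<in> F \<and> b \<in> F}"
      using D unfolding compact_family_def by simp
    then obtain a b where "D \<inter> {..<m} = a \<union> b" "a \<in> F" "b \<in> F" by blast
    then have "S m a" unfolding S_def using her[of b "a \<union> b - a"] by auto
    then show ?thesis by blast
  qed
  \<comment> \<open>\<open>Q k s\<close> says that \<open>s\<close> is the trace below
    \<open>k\<close> of splittings of arbitrarily long initial segments of \<open>D\<close>: a node
    of Koenig's tree with extensions at all levels.\<close>
  define Q where "Q k s \<longleftrightarrow> (\<forall>m\<ge>k. \<exists>a. S m a \<and> a \<inter> {..<k} = s)" for k s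
  have "\<exists>s. \<forall>k. Q k (s k) \<and> s (Suc k) \<inter> {..<k} = s k"
  proof (rule dependent_nat_choice)
    show "\<exists>s. Q 0 s" using ex unfolding Q_def by auto
    fix s k assume Q: "Q k s"
    show "\<exists>t. Q (Suc k) t \<and> t \<inter> {..<k} = s"
    proof (rule ccontr)
      assume "\<not> ?thesis"
      moreover have s: "s \<subseteq> {..<k}" using Q unfolding Q_def by blast
      then have "s \<inter> {..<k} = s" "insert k s \<inter> {..<k} = s" by auto
      ultimately have "\<not> Q (Suc k) s" "\<not> Q (Suc k) (insert k s)" by blast+
      then obtain m m' where m: "m \<ge> Suc k" "\<And>a. S m a \<Longrightarrow> a \<inter> {..<Suc k} \<noteq> s"
        and m': "m' \<ge> Suc k" "\<And>a. S m' a \<Longrightarrow> a \<inter> {..<Suc k} \<noteq> insert k s"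
        unfolding Q_def by blast
      \<comment> \<open>A splitting at level \<open>max m m'\<close> restricts to both
        \<open>m\<close> and \<open>m'\<close>, while its trace below \<open>Suc k\<close> is
        \<open>s\<close> or \<open>insert k s\<close>.\<close>
      obtain a where a: "S (max m m') a" "a \<inter> {..<k} = s"
        using Q m unfolding Q_def by (metis Suc_leD max.coboundedI1)
      have "a \<inter> {..<Suc k} = s \<or> a \<inter> {..<Suc k} = insert k s"
        using a(2) by (auto simp: lessThan_Suc)
      moreover have "(a \<inter> {..<m}) \<inter> {..<Suc k} = a \<inter> {..<Suc k}"
        "(a \<inter> {..<m'}) \<inter> {..<Suc k} = a \<inter> {..<Suc k}" using m m' by auto
      ultimately show False
        using m(2)[OF S_restrict[OF a(1)]] m'(2)[OF S_restrict[OF a(1)]] by auto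
    qed
  qed
  then obtain s where s: "\<And>k. Q k (s k)" "\<And>k. s (Suc k) \<inter> {..<k} = s k" by blast
  have sS: "S k (s k)" for k
  proof -
    obtain a where "S k a" "a \<inter> {..<k} = s k" using s(1)[of k] unfolding Q_def by blast
    moreover from this have "a = s k" unfolding S_def by auto
    ultimately show ?thesis by simp
  qed
  have s_le: "s l \<inter> {..<k} = s k" if "k \<le> l" for k l
    using that
  proof (induction l rule: dec_induct)
    case base
    then show ?case using sS[of k] unfolding S_def by blast
  next
    case (step l)
    have "s (Suc l) \<inter> {..<k} = (s (Suc l) \<inter> {..<l}) \<inter> {..<k}" using step.hyps by auto
    also have "\<dots> = s k" unfolding s(2) by (rule step.IH)
    finally show ?case .
  qed
  define a where "a = (\<Union>k. s k)"
  have a: "a \<inter> {..<k} = s k" for k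
  proof
    show "s k \<subseteq> a \<inter> {..<k}" using sS[of k] unfolding a_def S_def by auto
    show "a \<inter> {..<k} \<subseteq> s k"
    proof
      fix i assume "i \<in> a \<inter> {..<k}"
      then obtain l where "i \<in> s l" "i < k" unfolding a_def by blast
      then show "i \<in> s k"
        using s_le[of l k] s_le[of k l] nat_le_linear[of l k] by blast
    qed
  qed
  have "c \<in> F" if c: "finite c" "c \<subseteq> a" for c
  proof -
    obtain k where "c \<subseteq> {..<k}" using c by (auto simp: finite_nat_iff_bounded)
    then show ?thesis using a[of k] that sS[of k] her[of "s k" c] unfolding S_def by blast
  qed
  moreover have "c \<in> F" if c: "finite c" "c \<subseteq> D - a" for c
  proof -
    obtain k where "c \<subseteq> {..<k}" using c by (auto simp: finite_nat_iff_bounded)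
    then have "c \<subseteq> D \<inter> {..<k} - s k" using a[of k] that by blast
    then show ?thesis using sS[of k] her unfolding S_def by blast
  qed
  moreover have "a \<subseteq> D" using sS unfolding a_def S_def by blast
  then have "D = a \<union> (D - a)" by blast
  ultimately show ?thesis unfolding compact_family_def by blast
qed

text \<open>Enlarge the families to an increasing hereditary chain \<open>G\<close> with unions of
  two members of \<open>G n\<close> in \<open>G (Suc n)\<close>, and let \<open>X n\<close> be the
  finite subsets of \<open>B\<close> outside \<open>G n\<close>. Blocks that climb through
  \<open>G\<close> slowly and lie far out form a positive set whose part up to \<open>f n\<close>
  stays in \<open>G n\<close>.\<close>

lemma dominating_family_F_sigma:
  fixes F :: "nat \<Rightarrow> nat set set"
  assumes id: "ideal_on_omega I"
    and F_I: "\<And>n D. D \<in> compact_family (F n) \<Longrightarrow> D \<subseteq> B \<Longrightarrow> D \<in> I"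
    and cover: "\<And>D. D \<subseteq> B \<Longrightarrow> D \<in> I \<Longrightarrow> \<exists>n. D \<in> compact_family (F n)"
  shows "\<exists>X. dominating_family I B X"
proof -
  \<comment> \<open>The splitting lemma requires hereditary families, so only sets hereditarily in
    \<open>F n\<close> are kept.\<close>
  define H where "H n = {a. a \<subseteq> B \<and> finite a \<and> Pow a \<subseteq> F n}" for n
  \<comment> \<open>Starting with the singletons lets \<open>block\<close> below leave \<open>G n\<close> without leaving \<open>G (Suc n)\<close>.\<close>
  define G where "G = rec_nat {a. a \<subseteq> B \<and> finite a \<and> card a \<le> 1}
    (\<lambda>n g. {a \<union> b | a b. a \<in> g \<union> H n \<and> b \<in> g \<union> H n})"
  have G0: "G 0 = {a. a \<subseteq> B \<and> finite a \<and> card a \<le> 1}"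
    and GS: "G (Suc n) = {a \<union> b | a b. a \<in> G n \<union> H n \<and> b \<in> G n \<union> H n}" for n
    unfolding G_def by simp_all
  have herH: "b \<in> H n" if "a \<in> H n" "b \<subseteq> a" for a b n
    using that finite_subset unfolding H_def by blast
  have herG: "b \<in> G n" if "a \<in> G n" "b \<subseteq> a" for a b n
    using that
  proof (induction n arbitrary: a b)
    case 0
    then have "finite a" "card b \<le> card a" using card_mono G0 by auto
    then show ?case using 0 finite_subset[of b a] unfolding G0 by auto
  next
    case (Suc n)
    then obtain c d where "a = c \<union> d" "c \<in> G n \<union> H n" "d \<in> G n \<union> H n" unfolding GS by blast
    moreover have "e \<inter> b \<in> G n \<union> H n" if "e \<in> G n \<union> H n" for e
      using that Suc.IH[of e "e \<inter> b"] herH[of e n "e \<inter> b"] by blast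
    moreover from calculation have "b = (c \<inter> b) \<union> (d \<inter> b)" using Suc.prems by blast
    ultimately show ?case unfolding GS by blast
  qed
  have G_B: "a \<subseteq> B" if "a \<in> G n" for a n
    using that by (induction n arbitrary: a) (auto simp: G0 GS H_def)
  \<comment> \<open>Taking unions does not lead out of \<open>I\<close>: a member of the next
    compact family splits into two sets, each governed by \<open>G n\<close> or
    \<open>H n\<close>.\<close>
  have G_I: "D \<in> I" if "D \<in> compact_family (G n)" for D n
    using that
  proof (induction n arbitrary: D)
    case 0
    have "finite D"
    proof (rule ccontr)
      assume "infinite D"
      then obtain a where "finite a" "card a = 2" "a \<subseteq> D" by (meson infinite_arbitrarily_large)
      moreover from this have "a \<in> G 0" using 0 unfolding compact_family_def by blast
      ultimately show False unfolding G0 by simp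
    qed
    then show ?case using ideal_omega_finite[OF id] by blast
  next
    case (Suc n)
    have her: "b \<in> G n \<union> H n" if "a \<in> G n \<union> H n" "b \<subseteq> a" for a b
      using that herG herH by blast
    have "\<exists>a b. D = a \<union> b \<and> a \<in> compact_family (G n \<union> H n) \<and> b \<in> compact_family (G n \<union> H n)"
      by (rule compact_family_splits[OF her Suc.prems[unfolded GS]])
    then obtain a b where ab: "D = a \<union> b"
      "a \<in> compact_family (G n \<union> H n)" "b \<in> compact_family (G n \<union> H n)" by blast
    have "c \<in> I" if "c \<in> compact_family (G n \<union> H n)" for c
    proof -
      have "c \<in> compact_family (G n) \<or> c \<in> compact_family (H n)"
        by (rule compact_family_Un[OF that]) (rule herG herH, assumption+)+
      then consider "c \<in> compact_family (G n)" | "c \<in> compact_family (H n)" by blast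
      then show ?thesis
      proof cases
        case 1
        then show ?thesis by (rule Suc.IH)
      next
        case 2
        have "i \<in> B" if "i \<in> c" for i
        proof -
          have "{i} \<in> H n" using 2 that unfolding compact_family_def by simp
          then show ?thesis unfolding H_def by simp
        qed
        moreover have "c \<in> compact_family (F n)" using 2 unfolding compact_family_def H_def by blast
        ultimately show ?thesis using F_I by blast
      qed
    qed
    then show ?case using ab ideal_omega_Un[OF id] by blast
  qed
  have G_Suc: "G n \<subseteq> G (Suc n)" for n unfolding GS by blast
  have G_mono: "G m \<subseteq> G n" if "m \<le> n" for m n
    using lift_Suc_mono_le[of G, OF G_Suc that] .
  have G_Un: "a \<union> b \<in> G (Suc n)" if "a \<in> G n" "b \<in> G n" for a b n
    using that unfolding GS by blast
  have H_G: "H n \<subseteq> G (Suc n)" for n unfolding GS by blast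
  have G_single: "{i} \<in> G n" if "i \<in> B" for i n
    using that G_mono[of 0 n] unfolding G0 by auto
  have block: "\<exists>x\<subseteq>a. x \<notin> G n \<and> x \<in> G (Suc n)" if "finite a" "a \<subseteq> B" "a \<notin> G n" for a n
    using that
  proof (induction a rule: finite_induct)
    case empty
    then show ?case using G_mono[of 0 n] by (auto simp: G0)
  next
    case (insert i a)
    show ?case
    proof (cases "a \<in> G n")
      case True
      then have "insert i a \<in> G (Suc n)" using G_Un[of "{i}" n a] G_single insert by auto
      then show ?thesis using insert by blast
    next
      case False
      then show ?thesis using insert by blast
    qed
  qed
  define X where "X n = {x. finite x \<and> x \<subseteq> B \<and> x \<notin> G n}" for n
  have X: "\<exists>x\<in>X n. finite x \<and> x \<subseteq> C - {..<k}" if C: "C \<subseteq> B" "C \<notin> I" for C n k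
  proof -
    have "C - {..<k} \<notin> I" using ideal_omega_Diff_notin[OF id] ideal_omega_finite[OF id] C by blast
    then have "C - {..<k} \<notin> compact_family (G n)" using G_I by blast
    then show ?thesis using C unfolding compact_family_def X_def by blast
  qed
  moreover have "\<exists>D\<subseteq>C. D \<notin> I \<and> (\<exists>N. \<forall>n\<ge>N. \<forall>x\<in>X n. \<not> x \<subseteq> D \<inter> {..f n})"
    if C: "C \<subseteq> B" "C \<notin> I" for f :: "nat \<Rightarrow> nat" and C
  proof -
    \<comment> \<open>Every \<open>n\<close> with \<open>n div 2 \<le> j\<close> satisfies
      \<open>n \<le> 2 * j + 2\<close>, so the block \<open>x j\<close> will start beyond
      \<open>f n\<close> for all of them.\<close>
    define k where "k j = Suc (\<Sum>i\<le>2 * j + 2. f i)" for j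
    have "\<exists>x\<subseteq>C - {..<k j}. finite x \<and> x \<notin> G (2 * j) \<and> x \<in> G (Suc (2 * j))" for j
    proof -
      obtain a where a: "a \<in> X (2 * j)" "a \<subseteq> C - {..<k j}" using X C by blast
      then obtain x where "x \<subseteq> a" and "x \<notin> G (2 * j)" "x \<in> G (Suc (2 * j))"
        using block[of a "2 * j"] unfolding X_def by auto
      moreover have "finite x" using \<open>x \<subseteq> a\<close> a unfolding X_def by (auto intro: finite_subset)
      ultimately show ?thesis using a by blast
    qed
    then obtain x where x: "\<And>j. x j \<subseteq> C - {..<k j}" "\<And>j. finite (x j)"
      "\<And>j. x j \<notin> G (2 * j)" "\<And>j. x j \<in> G (Suc (2 * j))" by metis
    define D where "D = (\<Union>j. x j)"
    have D: "D \<subseteq> C" using x(1) unfolding D_def by blast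
    \<comment> \<open>Each block costs two levels of \<open>G\<close>: \<open>x j\<close> lies in
      \<open>G (Suc (2 * j))\<close>, and joining it to the earlier blocks uses one more.\<close>
    have E: "(\<Union>i<j. x i) \<in> G (2 * j)" for j
    proof (induction j)
      case 0
      then show ?case by (simp add: G0)
    next
      case (Suc j)
      then have "(\<Union>i<j. x i) \<union> x j \<in> G (Suc (Suc (2 * j)))"
        using G_Un G_Suc x(4) by blast
      moreover have "(\<Union>i<j. x i) \<union> x j = (\<Union>i<Suc j. x i)" by (auto simp: lessThan_Suc)
      ultimately show ?case by simp
    qed
    have "D \<inter> {..f n} \<in> G n" for n
    proof -
      have "D \<inter> {..f n} \<subseteq> (\<Union>i<n div 2. x i)"
      proof
        fix l assume "l \<in> D \<inter> {..f n}"
        then obtain i where i: "l \<in> x i" "l \<le> f n" unfolding D_def by blast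
        have "i < n div 2"
        proof (rule ccontr)
          assume "\<not> i < n div 2"
          then have "n \<le> 2 * i + 2" by linarith
          then have "f n \<le> (\<Sum>i\<le>2 * i + 2. f i)" by (intro member_le_sum) auto
          then show False using i x(1)[of i] unfolding k_def by auto
        qed
        then show "l \<in> (\<Union>i<n div 2. x i)" using i by blast
      qed
      then have "D \<inter> {..f n} \<in> G (2 * (n div 2))" using herG E by blast
      then show ?thesis using G_mono[of "2 * (n div 2)" n] by auto
    qed
    then have "\<not> y \<subseteq> D \<inter> {..f n}" if "y \<in> X n" for y n
      using that herG unfolding X_def by blast
    moreover have "D \<notin> I"
    proof
      assume "D \<in> I"
      \<comment> \<open>All finite subsets of \<open>D\<close> would then lie in \<open>H n\<close>,
        hence in \<open>G (Suc n)\<close>, but \<open>x (Suc n)\<close> is outside the larger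
        \<open>G (2 * Suc n)\<close>.\<close>
      then obtain n where n: "D \<in> compact_family (F n)" using cover D C by blast
      have "x (Suc n) \<subseteq> D" unfolding D_def by blast
      moreover have "a \<in> F n" if "a \<subseteq> x (Suc n)" for a
        using n that \<open>x (Suc n) \<subseteq> D\<close> finite_subset[OF that x(2)] unfolding compact_family_def by blast
      ultimately have "x (Suc n) \<in> H n" using x(2) D C unfolding H_def by blast
      then have "x (Suc n) \<in> G (2 * Suc n)" using H_G G_mono[of "Suc n" "2 * Suc n"] by auto
      then show False using x(3) by blast
    qed
    ultimately show ?thesis using D by blast
  qed
  ultimately have "dominating_family I B X" unfolding dominating_family_def by simp
  then show ?thesis by blast
qed

section \<open>Borel sets as projections\<close>

text \<open>Parity codes a set and leaves \<open>z n div 2\<close> free to carry a witness of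
  membership, so one sequence stores both.\<close>

definition odds :: "(nat \<Rightarrow> nat) \<Rightarrow> nat set" where
  "odds z = {n. odd (z n)}"

text \<open>In Polish spaces these are the analytic sets, as projections along Baire space.\<close>

definition souslin :: "('a::topological_space) set \<Rightarrow> bool" where
  "souslin S \<longleftrightarrow> (\<exists>M :: ('a \<times> (nat \<Rightarrow> nat)) set. closed M \<and> S = fst ` M)"

lemma souslin_closed: "closed S \<Longrightarrow> souslin S"
  unfolding souslin_def by (rule exI[of _ "S \<times> UNIV"]) (simp add: closed_Times)

text \<open>\<open>y 0\<close> selects the index and the shifted sequence is the witness, so the
  union becomes an intersection of closed conditions.\<close>

lemma souslin_UN:
  assumes "\<And>n::nat. souslin (S n)"
  shows "souslin (\<Union>n. S n)"
proof -
  obtain M where M: "\<And>n. closed (M n)" "\<And>n. S n = fst ` (M n :: ('a \<times> (nat \<Rightarrow> nat)) set)"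
    using assms unfolding souslin_def by metis
  define K where "K = (\<Inter>n. {(x, y). y 0 \<noteq> n \<or> (x, y \<circ> Suc) \<in> M n})"
  have "closed {(x, y). y 0 \<noteq> n \<or> (x, y \<circ> Suc) \<in> M n}" for n
  proof -
    have "continuous_on UNIV (\<lambda>p :: 'a \<times> (nat \<Rightarrow> nat). snd p 0)"
      by (rule continuous_on_product_then_coordinatewise) (rule continuous_on_snd[OF continuous_on_id])
    then have "closed ((\<lambda>p :: 'a \<times> (nat \<Rightarrow> nat). snd p 0) -` (- {n}))"
      by (intro closed_vimage) (auto simp: closed_def open_discrete)
    moreover have "continuous_on UNIV (\<lambda>p :: 'a \<times> (nat \<Rightarrow> nat). (fst p, snd p \<circ> Suc))"
      unfolding comp_def
      by (intro continuous_on_Pair continuous_on_fst continuous_on_id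
          continuous_on_coordinatewise_then_product
          continuous_on_product_then_coordinatewise[OF continuous_on_snd[OF continuous_on_id]])
    then have "closed ((\<lambda>p. (fst p, snd p \<circ> Suc)) -` M n)" by (intro closed_vimage M)
    moreover have "{(x, y). y 0 \<noteq> n \<or> (x, y \<circ> Suc) \<in> M n} =
        (\<lambda>p. snd p 0) -` (- {n}) \<union> (\<lambda>p. (fst p, snd p \<circ> Suc)) -` M n" by auto
    ultimately show ?thesis by (simp only: closed_Un)
  qed
  then have "closed K" unfolding K_def by blast
  moreover have "(\<Union>n. S n) = fst ` K"
  proof
    show "(\<Union>n. S n) \<subseteq> fst ` K"
    proof
      fix x assume "x \<in> (\<Union>n. S n)"
      then obtain n y where "(x, y) \<in> M n" using M(2) by fastforce
      then have "(x, case_nat n y) \<in> K" unfolding K_def by (auto simp: comp_def)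
      then show "x \<in> fst ` K" by force
    qed
    show "fst ` K \<subseteq> (\<Union>n. S n)"
    proof
      fix x assume "x \<in> fst ` K"
      then obtain y where "(x, y) \<in> K" by auto
      then have "(x, y \<circ> Suc) \<in> M (y 0)" unfolding K_def by auto
      then have "x \<in> S (y 0)" using M(2) by force
      then show "x \<in> (\<Union>n. S n)" by blast
    qed
  qed
  ultimately show ?thesis unfolding souslin_def by blast
qed

text \<open>One sequence carries witnesses for all \<open>n\<close> as its rows under
  \<open>prod_encode\<close>.\<close>

lemma souslin_INT:
  assumes "\<And>n::nat. souslin (S n)"
  shows "souslin (\<Inter>n. S n)"
proof -
  obtain M where M: "\<And>n. closed (M n)" "\<And>n. S n = fst ` (M n :: ('a \<times> (nat \<Rightarrow> nat)) set)"
    using assms unfolding souslin_def by metis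
  define row :: "nat \<Rightarrow> 'a \<times> (nat \<Rightarrow> nat) \<Rightarrow> 'a \<times> (nat \<Rightarrow> nat)"
    where "row n p = (fst p, \<lambda>k. snd p (prod_encode (n, k)))" for n p
  have "continuous_on UNIV (row n)" for n
    unfolding row_def
    by (intro continuous_on_Pair continuous_on_fst continuous_on_id
        continuous_on_coordinatewise_then_product
        continuous_on_product_then_coordinatewise[OF continuous_on_snd[OF continuous_on_id]])
  then have "closed (\<Inter>n. row n -` M n)" by (intro closed_INT closed_vimage M ballI)
  moreover have "(\<Inter>n. S n) = fst ` (\<Inter>n. row n -` M n)"
  proof
    show "(\<Inter>n. S n) \<subseteq> fst ` (\<Inter>n. row n -` M n)"
    proof
      fix x assume "x \<in> (\<Inter>n. S n)"
      then have "\<forall>n. \<exists>y. (x, y) \<in> M n" using M(2) by fastforce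
      then obtain y where y: "\<And>n. (x, y n) \<in> M n" by metis
      define w where "w k = (case prod_decode k of (n, m) \<Rightarrow> y n m)" for k
      have "row n (x, w) = (x, y n)" for n unfolding row_def w_def by simp
      then have "(x, w) \<in> (\<Inter>n. row n -` M n)" using y by simp
      then show "x \<in> fst ` (\<Inter>n. row n -` M n)" by force
    qed
    show "fst ` (\<Inter>n. row n -` M n) \<subseteq> (\<Inter>n. S n)"
      using M(2) unfolding row_def by force
  qed
  ultimately show ?thesis unfolding souslin_def by blast
qed

text \<open>An open set is the union of the cylinders it contains; these are closed and, being
  indexed by finite lists, countably many.\<close>

lemma souslin_open:
  fixes S :: "(nat \<Rightarrow> bool) set"
  assumes "open S"
  shows "souslin S"
proof -
  define cyl where "cyl l = {c :: nat \<Rightarrow> bool. map c [0..<length l] = l}" for l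
  have "closed (cyl l)" for l
  proof -
    have closed: "closed {c :: nat \<Rightarrow> bool. c i = l ! i}" for i
    proof -
      have "closed ((\<lambda>c :: nat \<Rightarrow> bool. c i) -` {l ! i})"
        by (rule closed_vimage) (auto simp: closed_def open_discrete)
      then show ?thesis by (simp add: vimage_def)
    qed
    have "cyl l = (\<Inter>i\<in>{..<length l}. {c. c i = l ! i})"
    proof -
      have "map c [0..<length l] = l \<longleftrightarrow> (\<forall>i<length l. c i = l ! i)" for c :: "nat \<Rightarrow> bool"
        by (subst list_eq_iff_nth_eq) simp
      then show ?thesis unfolding cyl_def by blast
    qed
    then show ?thesis using closed_INT[of "{..<length l}", OF ballI[OF closed]] by (simp only:)
  qed
  then have "souslin (cyl l)" for l by (rule souslin_closed)
  then have "souslin (\<Union>n. if cyl (from_nat n) \<subseteq> S then cyl (from_nat n) else {})"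
    by (intro souslin_UN) (simp add: souslin_closed)
  moreover have "(\<Union>n. if cyl (from_nat n) \<subseteq> S then cyl (from_nat n) else {}) = S"
  proof
    show "S \<subseteq> (\<Union>n. if cyl (from_nat n) \<subseteq> S then cyl (from_nat n) else {})"
    proof
      fix c assume "c \<in> S"
      then have "\<exists>X. c \<in> PiE UNIV X \<and> (\<forall>i. openin euclidean (X i)) \<and>
          finite {i. X i \<noteq> topspace euclidean} \<and> PiE UNIV X \<subseteq> S"
        by (rule product_topology_open_contains_basis[OF assms[unfolded open_fun_def]])
      then obtain X where X: "c \<in> PiE UNIV X" "finite {i. X i \<noteq> UNIV}" "PiE UNIV X \<subseteq> S"
        unfolding topspace_euclidean by blast
      obtain l where l: "{i. X i \<noteq> UNIV} \<subseteq> {..<l}" using X(2) by (auto simp: finite_nat_iff_bounded)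
      let ?l = "map c [0..<l]"
      have "c' \<in> S" if "c' \<in> cyl ?l" for c'
      proof -
        have "c' i \<in> X i" for i
        proof (cases "i < l")
          case True
          then have "c' i = c i" using that unfolding cyl_def by simp
          then show ?thesis using X(1) by auto
        next
          case False
          then have "X i = UNIV" using l by blast
          then show ?thesis by simp
        qed
        then show ?thesis using X(3) by auto
      qed
      then have sub: "cyl ?l \<subseteq> S" by blast
      have "c \<in> cyl ?l" unfolding cyl_def by simp
      then show "c \<in> (\<Union>n. if cyl (from_nat n) \<subseteq> S then cyl (from_nat n) else {})"
        using sub by (intro UN_I[of "to_nat ?l"]) auto
    qed
  qed (auto split: if_splits)
  ultimately show ?thesis by simp
qed

text \<open>The induction treats \<open>S\<close> and its complement together, as analytic sets are
  not closed under complement.\<close>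

lemma souslin_borel:
  fixes S :: "(nat \<Rightarrow> bool) set"
  assumes "S \<in> sets borel"
  shows "souslin S"
proof -
  have "S \<in> sigma_sets UNIV {S. open S}" using assms by (simp add: borel_def)
  then have "souslin S \<and> souslin (- S)"
  proof (induction rule: sigma_sets.induct)
    case (Basic a)
    then show ?case by (simp add: souslin_open souslin_closed closed_Compl)
  next
    case Empty
    show ?case by (simp add: souslin_closed)
  next
    case (Compl a)
    then show ?case by (simp add: Compl_eq_Diff_UNIV[symmetric])
  next
    case (Union a)
    then show ?case using souslin_UN[of a] souslin_INT[of "\<lambda>n. - a n"] by simp
  qed
  then show ?thesis by blast
qed

text \<open>Interleaving a characteristic function with its witness through \<open>h\<close> pulls
  \<open>M\<close> back to a closed subset of Baire space. Closedness is phrased by initial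
  segments, ready for building branches.\<close>

lemma borel_family_odds:
  assumes "borel_family I"
  obtains R where "I = odds ` R" "\<And>z. (\<And>l. \<exists>z'\<in>R. \<forall>i<l. z' i = z i) \<Longrightarrow> z \<in> R"
proof -
  obtain M :: "((nat \<Rightarrow> bool) \<times> (nat \<Rightarrow> nat)) set" where
    M: "closed M" "{c. {n. c n} \<in> I} = fst ` M"
    using souslin_borel assms unfolding borel_family_def souslin_def by blast
  define h :: "(nat \<Rightarrow> nat) \<Rightarrow> (nat \<Rightarrow> bool) \<times> (nat \<Rightarrow> nat)"
    where "h z = (\<lambda>n. odd (z n), \<lambda>n. z n div 2)" for z
  have cont: "continuous_on UNIV (\<lambda>z :: nat \<Rightarrow> nat. f (z n))" for f :: "nat \<Rightarrow> 'b::topological_space" and n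
  proof -
    have "continuous_on UNIV f" by (simp add: continuous_on_open_vimage open_discrete)
    then show ?thesis
      using continuous_on_compose2[of UNIV f UNIV "\<lambda>z :: nat \<Rightarrow> nat. z n"] by simp
  qed
  have "continuous_on UNIV h"
    unfolding h_def by (intro continuous_on_Pair continuous_on_coordinatewise_then_product cont)
  then have R: "closed (h -` M)" using M(1) by (intro closed_vimage)
  have fst_h: "fst (h z) = (\<lambda>n. n \<in> odds z)" for z unfolding h_def odds_def by simp
  have "I = odds ` (h -` M)"
  proof
    show "I \<subseteq> odds ` (h -` M)"
    proof
      fix A assume "A \<in> I"
      then have "(\<lambda>n. n \<in> A) \<in> fst ` M" using M(2) by auto
      then obtain y where y: "(\<lambda>n. n \<in> A, y) \<in> M" by auto
      define z where "z n = 2 * y n + (if n \<in> A then 1 else 0)" for n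
      have "h z = (\<lambda>n. n \<in> A, y)" unfolding h_def z_def by auto
      moreover have "odds z = A" unfolding odds_def z_def by auto
      ultimately show "A \<in> odds ` (h -` M)" using y by force
    qed
    show "odds ` (h -` M) \<subseteq> I"
    proof
      fix A assume "A \<in> odds ` (h -` M)"
      then obtain z where "h z \<in> M" "A = odds z" by blast
      then have "fst (h z) \<in> {c. {n. c n} \<in> I}" unfolding M(2) by (intro imageI)
      then have "(\<lambda>n. n \<in> A) \<in> {c. {n. c n} \<in> I}" using fst_h \<open>A = odds z\<close> by simp
      then show "A \<in> I" by simp
    qed
  qed
  moreover have "z \<in> h -` M" if z: "\<And>l. \<exists>z'\<in>h -` M. \<forall>i<l. z' i = z i" for z
  proof -
    obtain Z where Z: "\<And>l. Z l \<in> h -` M" "\<And>l i. i < l \<Longrightarrow> Z l i = z i" using z by metis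
    have "((\<lambda>l. Z l i) \<longlongrightarrow> z i) sequentially" for i
      by (rule tendsto_eventually) (use Z(2) in \<open>auto intro: eventually_sequentiallyI[of "Suc i"]\<close>)
    then have "limitin (product_topology (\<lambda>i. euclidean) UNIV) Z z sequentially"
      by (simp add: limitin_componentwise)
    then have "(Z \<longlongrightarrow> z) sequentially" by (simp add: euclidean_product_topology)
    then show ?thesis
      using Lim_in_closed_set[OF R, of Z sequentially z] Z(1) by simp
  qed
  ultimately show ?thesis by (rule that)
qed

section \<open>Separation by \<open>F\<^sub>\<sigma>\<close> sets\<close>

definition node :: "(nat \<Rightarrow> nat) set \<Rightarrow> nat list \<Rightarrow> (nat \<Rightarrow> nat) set" where
  "node R s = {z \<in> R. map z [0..<length s] = s}"

lemma node_map: "z \<in> R \<Longrightarrow> z \<in> node R (map z [0..<n])"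
  unfolding node_def by simp

lemma node_map_nth: "z' \<in> node R (map z [0..<n]) \<Longrightarrow> i < n \<Longrightarrow> z' i = z i"
  unfolding node_def by simp

lemma branch_limit:
  fixes u :: "nat \<Rightarrow> nat list"
  assumes closed: "\<And>z. (\<And>l. \<exists>z'\<in>R. \<forall>i<l. z' i = z i) \<Longrightarrow> z \<in> R"
    and ne: "\<And>n. node R (u n) \<noteq> {}"
    and ext: "\<And>n. \<exists>w. u (Suc n) = u n @ w \<and> w \<noteq> []"
  shows "\<exists>z. \<forall>n. z \<in> node R (u n)"
proof -
  have len: "n \<le> length (u n)" for n
  proof (induction n)
    case (Suc n)
    then show ?case using ext[of n] by (auto simp: Suc_le_eq length_greater_0_conv[symmetric] simp del: length_greater_0_conv)
  qed simp
  have pre: "\<exists>w. u n = u m @ w" if "m \<le> n" for m n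
    using that
  proof (induction n rule: dec_induct)
    case (step n)
    then show ?case using ext[of n] by auto
  qed simp
  have nth: "u n ! i = u m ! i" if "i < length (u m)" "i < length (u n)" for m n i
    using pre[of m n] pre[of n m] that nat_le_linear[of m n] by (auto simp: nth_append)
  \<comment> \<open>Entry \<open>i\<close> exists in \<open>u (Suc i)\<close>, since
    \<open>u n\<close> has length at least \<open>n\<close>.\<close>
  define z where "z i = u (Suc i) ! i" for i
  have z: "map z [0..<length (u n)] = u n" for n
  proof (rule nth_equalityI)
    fix i assume "i < length (map z [0..<length (u n)])"
    then show "map z [0..<length (u n)] ! i = u n ! i"
      using nth[of i "Suc i" n] len[of "Suc i"] by (simp add: z_def)
  qed simp
  have "z \<in> R"
  proof (rule closed)
    fix l
    obtain z' where z': "z' \<in> node R (u l)" using ne by blast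
    then have "z' \<in> node R (map z [0..<length (u l)])" using z by simp
    then have "\<forall>i<l. z' i = z i" using node_map_nth len[of l] by (metis order_less_le_trans)
    then show "\<exists>z'\<in>R. \<forall>i<l. z' i = z i" using z' unfolding node_def by blast
  qed
  then show ?thesis using z unfolding node_def by blast
qed

text \<open>\<open>S\<close> is covered by an \<open>F\<^sub>\<sigma>\<close> set whose members
  below \<open>B\<close> are in \<open>I\<close>. For \<open>S = I\<close> this makes the
  restriction of \<open>I\<close> to \<open>B\<close> an \<open>F\<^sub>\<sigma>\<close>
  ideal.\<close>

definition sigma_bounded :: "nat set set \<Rightarrow> nat set set \<Rightarrow> nat set \<Rightarrow> bool" where
  "sigma_bounded I S B \<longleftrightarrow> (\<exists>F :: nat \<Rightarrow> nat set set.
     (\<forall>n. compact_family (F n) \<inter> Pow B \<subseteq> I) \<and> S \<subseteq> (\<Union>n. compact_family (F n)))"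

lemma sigma_bounded_subset: "sigma_bounded I S B \<Longrightarrow> T \<subseteq> S \<Longrightarrow> sigma_bounded I T B"
  unfolding sigma_bounded_def by blast

lemma sigma_bounded_empty: "sigma_bounded I {} B"
proof -
  have "compact_family {} = {}" unfolding compact_family_def by blast
  then show ?thesis unfolding sigma_bounded_def by (intro exI[of _ "\<lambda>_. {}"]) simp
qed

lemma sigma_bounded_compact_family:
  "compact_family F \<inter> Pow B \<subseteq> I \<Longrightarrow> sigma_bounded I (compact_family F) B"
  unfolding sigma_bounded_def by (rule exI[of _ "\<lambda>_. F"]) simp

text \<open>The same families work: \<open>D \<inter> B\<close> stays in its compact family by
  heredity, and the rest of \<open>D\<close> lies in \<open>C - B\<close>.\<close>

lemma sigma_bounded_below:
  assumes "ideal_on_omega I" "sigma_bounded I S B" "C - B \<in> I"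
  shows "sigma_bounded I S C"
proof -
  obtain F :: "nat \<Rightarrow> nat set set" where
    F: "\<And>n. compact_family (F n) \<inter> Pow B \<subseteq> I" "S \<subseteq> (\<Union>n. compact_family (F n))"
    using assms(2) unfolding sigma_bounded_def by blast
  have "D \<in> I" if "D \<in> compact_family (F n)" "D \<subseteq> C" for n D
  proof -
    have "D \<inter> B \<in> compact_family (F n)" using compact_family_subset that by blast
    then have "D \<inter> B \<in> I" using F(1) by blast
    then show ?thesis
      by (rule ideal_omega_subset_Un[OF assms(1) _ assms(3)]) (use that in blast)
  qed
  then have "\<forall>n. compact_family (F n) \<inter> Pow C \<subseteq> I" by blast
  then show ?thesis using F(2) unfolding sigma_bounded_def by blast
qed

lemma sigma_bounded_UN:
  assumes "\<And>n::nat. sigma_bounded I (S n) B"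
  shows "sigma_bounded I (\<Union>n. S n) B"
proof -
  have "\<forall>n. \<exists>F :: nat \<Rightarrow> nat set set.
     (\<forall>m. compact_family (F m) \<inter> Pow B \<subseteq> I) \<and> S n \<subseteq> (\<Union>m. compact_family (F m))"
    using assms unfolding sigma_bounded_def by blast
  then obtain F :: "nat \<Rightarrow> nat \<Rightarrow> nat set set" where
    F: "\<And>n m. compact_family (F n m) \<inter> Pow B \<subseteq> I" "\<And>n. S n \<subseteq> (\<Union>m. compact_family (F n m))"
    by metis
  define F' where "F' k = (case prod_decode k of (n, m) \<Rightarrow> F n m)" for k
  have "F n m = F' (prod_encode (n, m))" for n m unfolding F'_def by simp
  then have "(\<Union>n. S n) \<subseteq> (\<Union>k. compact_family (F' k))" using F(2) by fastforce
  moreover have "compact_family (F' k) \<inter> Pow B \<subseteq> I" for k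
    unfolding F'_def using F(1) by (cases "prod_decode k") simp
  ultimately show ?thesis unfolding sigma_bounded_def by blast
qed

lemma sigma_bounded_Un:
  assumes "sigma_bounded I S B" "sigma_bounded I T B"
  shows "sigma_bounded I (S \<union> T) B"
proof -
  have "sigma_bounded I (\<Union>n::nat. if n = 0 then S else T) B"
    by (rule sigma_bounded_UN) (use assms in simp)
  then show ?thesis by (rule sigma_bounded_subset) (auto split: if_splits)
qed

text \<open>Otherwise \<open>R\<close> has a kernel such that the closure of each nonempty node
  contains positive sets. By distributivity and \<open>p_point\<close>, some positive
  \<open>E\<close> is almost contained in one such set for every node; then two branches of
  \<open>R\<close> cover \<open>E\<close> up to a finite set, which puts \<open>E\<close> into
  \<open>I\<close>.\<close>

lemma ideal_somewhere_sigma_bounded: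
  assumes id: "ideal_on_omega I"
    and nr: "adds_no_reals (quotient_conds I) (quotient_le I)"
    and closed: "\<And>z. (\<And>l. \<exists>z'\<in>R. \<forall>i<l. z' i = z i) \<Longrightarrow> z \<in> R"
    and I_R: "I = odds ` R"
    and A: "A \<notin> I"
    and p_point: "\<And>B (D :: nat \<Rightarrow> nat set). B \<subseteq> A \<Longrightarrow> B \<notin> I \<Longrightarrow> (\<And>n. B - D n \<in> I) \<Longrightarrow>
      \<exists>C\<subseteq>B. C \<notin> I \<and> (\<forall>n. finite (C - D n))"
  shows "\<exists>B\<subseteq>A. B \<notin> I \<and> sigma_bounded I I B"
proof (rule ccontr)
  assume "\<not> ?thesis"
  then have unb_I: "\<not> sigma_bounded I I B" if "B \<subseteq> A" "B \<notin> I" for B using that by blast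

  \<comment> \<open>The kernel of nowhere bounded nodes\<close>
  let ?p = "\<lambda>s. odds ` node R s"
  let ?s = "from_nat :: nat \<Rightarrow> nat list"
  have s_surj: "\<exists>n. ?s n = s" for s by (metis from_nat_to_nat)
  \<comment> \<open>These sets settle boundedness of the node \<open>s\<close>, positively or
    negatively for all positive almost-subsets at once. They are open and dense, so one
    \<open>B\<close> settles all nodes.\<close>
  define dec where "dec s = {B. sigma_bounded I (?p s) B \<or>
    (\<forall>C. C \<notin> I \<longrightarrow> C - B \<in> I \<longrightarrow> \<not> sigma_bounded I (?p s) C)}" for s
  have "\<exists>B\<subseteq>A. B \<notin> I \<and> (\<forall>n. B \<in> dec (?s n))"
  proof (rule adds_no_reals_distributive_below[OF id nr A])
    fix n C assume C: "C \<subseteq> A" "C \<notin> I"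
    show "\<exists>B\<subseteq>C. B \<notin> I \<and> B \<in> dec (?s n)"
    proof (cases "C \<in> dec (?s n)")
      case False
      then obtain B where B: "B \<notin> I" "B - C \<in> I" "sigma_bounded I (?p (?s n)) B"
        unfolding dec_def by blast
      have "B \<inter> C - B \<in> I" by (rule ideal_omega_Diff_subset[OF id]) blast
      then have "sigma_bounded I (?p (?s n)) (B \<inter> C)" using sigma_bounded_below[OF id B(3)] by blast
      moreover have "B \<inter> C \<notin> I"
        using ideal_omega_subset_Un[OF id B(2), of "B \<inter> C" B] B(1) by blast
      ultimately show ?thesis unfolding dec_def by (intro exI[of _ "B \<inter> C"]) auto
    qed (use C in blast)
  next
    fix n B C assume B: "B \<in> dec (?s n)" "C - B \<in> I"
    have "C' - B \<in> I" if "C' - C \<in> I" for C'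
      by (rule ideal_omega_subset_Un[OF id that B(2)]) blast
    then show "C \<in> dec (?s n)" using B sigma_bounded_below[OF id _ B(2)] unfolding dec_def by blast
  qed
  then obtain B where B: "B \<subseteq> A" "B \<notin> I" and dec: "\<And>s. B \<in> dec s" by (metis s_surj)
  \<comment> \<open>A Cantor-Bendixson type kernel: nonempty nodes of \<open>R'\<close> are unbounded below every positive
    subset of \<open>B\<close>.\<close>
  define R' where "R' = {z \<in> R. \<forall>s. z \<in> node R s \<longrightarrow> \<not> sigma_bounded I (?p s) B}"
  \<comment> \<open>There are only countably many nodes, so what \<open>R'\<close> loses is a
    countable union of bounded pieces.\<close>
  have cover: "?p s \<subseteq> odds ` node R' s \<union>
      (\<Union>n. if sigma_bounded I (?p (?s n)) B then ?p (?s n) else {})" for s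
  proof
    fix x assume "x \<in> ?p s"
    then obtain z where z: "x = odds z" "z \<in> node R s" by blast
    show "x \<in> odds ` node R' s \<union> (\<Union>n. if sigma_bounded I (?p (?s n)) B then ?p (?s n) else {})"
    proof (cases "z \<in> R'")
      case True
      then show ?thesis using z unfolding node_def by blast
    next
      case False
      then obtain t where t: "z \<in> node R t" "sigma_bounded I (?p t) B"
        using z unfolding R'_def node_def by blast
      obtain n where "?s n = t" using s_surj by blast
      then have "x \<in> (if sigma_bounded I (?p (?s n)) B then ?p (?s n) else {})" using t z by simp
      then show ?thesis by blast
    qed
  qed
  have rest: "sigma_bounded I (\<Union>n. if sigma_bounded I (?p (?s n)) B then ?p (?s n) else {}) B"
    by (rule sigma_bounded_UN) (simp add: sigma_bounded_empty)
  \<comment> \<open>Boundedness of a kernel node below \<open>C\<close> would spread to the whole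
    node of \<open>R\<close>, then from \<open>C\<close> to \<open>B\<close> because
    \<open>B\<close> decides, contradicting the definition of \<open>R'\<close>.\<close>
  have unb: "\<not> sigma_bounded I (odds ` node R' s) C"
    if s: "node R' s \<noteq> {}" and C: "C \<subseteq> B" "C \<notin> I" for s C
  proof
    assume "sigma_bounded I (odds ` node R' s) C"
    moreover have CB: "C - B \<in> I" using ideal_omega_Diff_subset[OF id] C by blast
    ultimately have "sigma_bounded I (?p s) C"
      using sigma_bounded_subset[OF sigma_bounded_Un cover] sigma_bounded_below[OF id rest] by blast
    then have "sigma_bounded I (?p s) B" using dec[of s] CB C unfolding dec_def by blast
    moreover obtain z where "z \<in> R'" "z \<in> node R s" using s unfolding node_def R'_def by blast
    ultimately show False unfolding R'_def by blast
  qed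
  have root: "node R' [] \<noteq> {}"
  proof
    assume "node R' [] = {}"
    then have "?p [] \<subseteq> (\<Union>n. if sigma_bounded I (?p (?s n)) B then ?p (?s n) else {})"
      using cover[of "[]"] by (simp only: image_empty Un_empty_left)
    then have "sigma_bounded I (?p []) B" by (rule sigma_bounded_subset[OF rest])
    moreover have "?p [] = I" unfolding I_R node_def by simp
    ultimately show False using unb_I[OF B] by (simp only:)
  qed

  \<comment> \<open>Positive sets in the closures of the kernel nodes\<close>
  define H where "H s = compact_family {a. \<exists>z\<in>node R' s. a \<subseteq> odds z}" for s
  have "\<exists>C\<subseteq>B. C \<notin> I \<and> (\<forall>n. C \<in> {C. node R' (?s n) \<noteq> {} \<longrightarrow> (\<exists>D\<in>H (?s n). C - D \<in> I)})"
  proof (rule adds_no_reals_distributive_below[OF id nr B(2)])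
    fix n C assume C: "C \<subseteq> B" "C \<notin> I"
    show "\<exists>D\<subseteq>C. D \<notin> I \<and> D \<in> {C. node R' (?s n) \<noteq> {} \<longrightarrow> (\<exists>D\<in>H (?s n). C - D \<in> I)}"
    proof (cases "node R' (?s n) = {}")
      case False
      \<comment> \<open>The single compact family \<open>H (?s n)\<close> contains all sets coded in
        an unbounded node, so it must have a positive member below \<open>C\<close>.\<close>
      have "\<not> sigma_bounded I (H (?s n)) C"
      proof
        assume "sigma_bounded I (H (?s n)) C"
        moreover have "odds ` node R' (?s n) \<subseteq> H (?s n)" unfolding H_def compact_family_def by blast
        ultimately show False using sigma_bounded_subset unb[OF False C] by blast
      qed
      then obtain D where D: "D \<in> H (?s n)" "D \<subseteq> C" "D \<notin> I"
        using sigma_bounded_compact_family unfolding H_def by blast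
      moreover have "D - D \<in> I" using ideal_omega_Diff_subset[OF id] by blast
      ultimately show ?thesis by blast
    qed (use C in blast)
  next
    fix n C E
    assume C: "C \<in> {C. node R' (?s n) \<noteq> {} \<longrightarrow> (\<exists>D\<in>H (?s n). C - D \<in> I)}" "E - C \<in> I"
    have "E - D \<in> I" if "C - D \<in> I" for D
      by (rule ideal_omega_subset_Un[OF id that C(2)]) blast
    then show "E \<in> {C. node R' (?s n) \<noteq> {} \<longrightarrow> (\<exists>D\<in>H (?s n). C - D \<in> I)}" using C by blast
  qed
  then obtain C where C: "C \<subseteq> B" "C \<notin> I"
    and ex_D: "\<And>n. node R' (?s n) \<noteq> {} \<Longrightarrow> \<exists>D\<in>H (?s n). C - D \<in> I" by blast
  have "\<forall>s. \<exists>D. node R' s \<noteq> {} \<longrightarrow> D \<in> H s \<and> C - D \<in> I"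
    using ex_D s_surj by metis
  then obtain D where D: "\<And>s. node R' s \<noteq> {} \<Longrightarrow> D s \<in> H s" "\<And>s. node R' s \<noteq> {} \<Longrightarrow> C - D s \<in> I"
    by metis
  \<comment> \<open>The default \<open>UNIV\<close> makes the requirements at empty nodes
    trivial.\<close>
  define D' where "D' n = (if node R' (?s n) = {} then UNIV else D (?s n))" for n
  have "C - D' n \<in> I" for n using D ideal_omega_finite[OF id, of "{}"] by (simp add: D'_def)
  then obtain E where E: "E \<subseteq> C" "E \<notin> I" "\<And>n. finite (E - D' n)"
    using p_point[of C D'] B C by blast
  have "\<exists>g. node R' s \<noteq> {} \<longrightarrow> E - D s \<subseteq> {..<g}" for s
  proof (cases "node R' s = {}")
    case False
    obtain n where "?s n = s" using s_surj by blast
    then have "finite (E - D s)" using E(3)[of n] False by (simp add: D'_def)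
    then show ?thesis by (auto simp: finite_nat_iff_bounded)
  qed simp
  then obtain g where g: "\<And>s. node R' s \<noteq> {} \<Longrightarrow> E - D s \<subseteq> {..<g s}" by metis

  \<comment> \<open>Two branches covering a positive set\<close>
  have step: "\<exists>w. w \<noteq> [] \<and> node R' (s @ w) \<noteq> {} \<and> (\<forall>z\<in>node R (s @ w). E \<inter> {k..<k'} \<subseteq> odds z)"
    if s: "node R' s \<noteq> {}" "g s \<le> k" for s k k'
  proof -
    \<comment> \<open>Beyond \<open>g s\<close> the set \<open>E\<close> lies inside
      \<open>D s\<close>, whose finite subsets are covered by sets coded in the kernel node.\<close>
    have "E \<inter> {k..<k'} \<subseteq> D s" using g[OF s(1)] s(2) by force
    moreover have "finite (E \<inter> {k..<k'})" by simp
    ultimately have "E \<inter> {k..<k'} \<in> {a. \<exists>z\<in>node R' s. a \<subseteq> odds z}"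
      using D(1)[OF s(1)] unfolding H_def compact_family_def by blast
    then obtain z where z: "z \<in> node R' s" "E \<inter> {k..<k'} \<subseteq> odds z" by blast
    \<comment> \<open>\<open>L \<ge> k'\<close> fixes the parities below \<open>k'\<close>
      throughout the node \<open>s @ w\<close>; \<open>length s + 1\<close> makes \<open>w\<close>
      nonempty.\<close>
    define L where "L = max k' (length s + 1)"
    define w where "w = map z [length s..<L]"
    have "[0..<L] = [0..<length s] @ [length s..<L]"
      using upt_add_eq_append[of 0 "length s" "L - length s"] by (simp add: L_def)
    then have sw: "s @ w = map z [0..<L]" using z(1) unfolding w_def node_def by simp
    have "w \<noteq> []" unfolding w_def L_def by simp
    moreover have "node R' (s @ w) \<noteq> {}"
      unfolding sw using node_map[of z R'] z(1) unfolding node_def by blast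
    moreover have "E \<inter> {k..<k'} \<subseteq> odds z'" if "z' \<in> node R (s @ w)" for z'
    proof
      fix i assume i: "i \<in> E \<inter> {k..<k'}"
      then have "z' i = z i" using node_map_nth that unfolding sw L_def by auto
      then show "i \<in> odds z'" using i z(2) unfolding odds_def by auto
    qed
    ultimately show ?thesis by blast
  qed
  \<comment> \<open>Two branches of \<open>R\<close> are built in parallel, one covering the even and the other the odd blocks
    of \<open>E\<close>; each block is long enough that the node \<open>s'\<close> waiting for its turn is ready at its end.\<close>
  define ok where "ok = (\<lambda>(k, s, s'). node R' s \<noteq> {} \<and> node R' s' \<noteq> {} \<and> g s \<le> k)"
  define nxt :: "nat \<times> nat list \<times> nat list \<Rightarrow> nat \<times> nat list \<times> nat list \<Rightarrow> bool" where "nxt = (\<lambda>(k, s, s') (k', t, u). k < k' \<and> t = s' \<and> (\<exists>w. u = s @ w \<and> w \<noteq> []) \<and>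
    (\<forall>z\<in>node R u. E \<inter> {k..<k'} \<subseteq> odds z))"
  have "\<exists>st. \<forall>n::nat. ok (st n) \<and> nxt (st n) (st (Suc n))"
  proof (rule dependent_nat_choice)
    show "\<exists>x. ok x" using root unfolding ok_def by (intro exI[of _ "(g [], [], [])"]) simp
    fix x and n :: nat assume x: "ok x"
    obtain k s s' where e: "x = (k, s, s')" by (metis surj_pair)
    define k' where "k' = max (Suc k) (g s')"
    obtain w where "w \<noteq> []" "node R' (s @ w) \<noteq> {}" "\<forall>z\<in>node R (s @ w). E \<inter> {k..<k'} \<subseteq> odds z"
      using step[of s k k'] x e unfolding ok_def by auto
    then have "ok (k', s', s @ w)" "nxt x (k', s', s @ w)"
      using x unfolding e ok_def nxt_def k'_def by auto
    then show "\<exists>y. ok y \<and> nxt x y" by blast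
  qed
  then obtain st where st: "\<And>n::nat. ok (st n)" "\<And>n. nxt (st n) (st (Suc n))" by blast
  define k where "k n = fst (st n)" for n
  \<comment> \<open>\<open>t n\<close> is the node extended at stage \<open>n\<close>. The two nodes
    swap roles, so its extension is \<open>t (Suc (Suc n))\<close>, and the even and the odd indices
    give the two branches.\<close>
  define t where "t n = fst (snd (st n))" for n
  have t_ne: "node R' (t n) \<noteq> {}" for n
    using st(1)[of n] unfolding ok_def t_def by (auto split: prod.splits)
  have t': "snd (snd (st n)) = t (Suc n)" for n
    using st(2)[of n] unfolding nxt_def t_def by (auto split: prod.splits)
  have k: "k n < k (Suc n)" for n
    using st(2)[of n] unfolding nxt_def k_def by (auto split: prod.splits)
  have t_ext: "\<exists>w. t (Suc (Suc n)) = t n @ w \<and> w \<noteq> []" for n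
    using st(2)[of n] t'[of "Suc n"] unfolding nxt_def t_def by (auto split: prod.splits)
  have t_odds: "E \<inter> {k n..<k (Suc n)} \<subseteq> odds z" if "z \<in> node R (t (Suc (Suc n)))" for n z
    using st(2)[of n] t'[of "Suc n"] that unfolding nxt_def k_def by (auto split: prod.splits)
  have run: "\<exists>z\<in>R. \<forall>n. E \<inter> {k (2 * n + c)..<k (Suc (2 * n + c))} \<subseteq> odds z" for c
  proof -
    have "node R' s \<subseteq> node R s" for s unfolding node_def R'_def by blast
    then have "\<exists>z. \<forall>n. z \<in> node R (t (2 * n + c))"
      using branch_limit[OF closed, of "\<lambda>n. t (2 * n + c)"] t_ne t_ext by fastforce
    then obtain z where z: "\<And>n. z \<in> node R (t (2 * n + c))" by blast
    \<comment> \<open>The node securing the block of stage \<open>2 * n + c\<close> has index two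
      higher, hence \<open>z\<close> is used at \<open>Suc n\<close>.\<close>
    have "E \<inter> {k (2 * n + c)..<k (Suc (2 * n + c))} \<subseteq> odds z" for n
      using t_odds[of z "2 * n + c"] z[of "Suc n"] by simp
    moreover have "z \<in> R" using z unfolding node_def by blast
    ultimately show ?thesis by blast
  qed
  obtain z0 where z0: "z0 \<in> R" "\<And>n. E \<inter> {k (2 * n)..<k (Suc (2 * n))} \<subseteq> odds z0"
    using run[of 0] by auto
  obtain z1 where z1: "z1 \<in> R" "\<And>n. E \<inter> {k (2 * n + 1)..<k (Suc (2 * n + 1))} \<subseteq> odds z1"
    using run[of 1] by blast
  have "E \<subseteq> {..<k 0} \<union> (odds z0 \<union> odds z1)"
  proof
    fix i assume i: "i \<in> E"
    show "i \<in> {..<k 0} \<union> (odds z0 \<union> odds z1)"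
    proof (cases "i < k 0")
      case False
      have "strict_mono k" using k by (simp add: strict_mono_Suc_iff)
      then have "i < k (Suc i)" using strict_mono_imp_increasing[of k "Suc i"] by linarith
      then have least: "i < k (LEAST n. i < k n)" by (rule LeastI)
      \<comment> \<open>The first \<open>k n\<close> above \<open>i\<close> has positive index
        because \<open>k 0 \<le> i\<close>; its predecessor starts the block containing
        \<open>i\<close>.\<close>
      then obtain n where n: "(LEAST n. i < k n) = Suc n" using False by (cases "LEAST n. i < k n") auto
      then have "k n \<le> i" using not_less_Least[of n "\<lambda>n. i < k n"] by simp
      then have mem: "i \<in> E \<inter> {k n..<k (Suc n)}" using i least n by simp
      consider m where "n = 2 * m" | m where "n = 2 * m + 1" by (metis evenE oddE)
      then show ?thesis
      proof cases
        case 1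
        then have "i \<in> odds z0" using mem z0(2) by blast
        then show ?thesis by simp
      next
        case 2
        then have "i \<in> odds z1" using mem z1(2) by blast
        then show ?thesis by simp
      qed
    qed simp
  qed
  moreover have "odds z0 \<union> odds z1 \<in> I" using z0 z1 I_R ideal_omega_Un[OF id] by blast
  ultimately have "E \<in> I"
    using ideal_omega_subset_Un[OF id, of "{..<k 0}"] ideal_omega_finite[OF id] by blast
  then show False using E by blast
qed

theorem proposition13:
  fixes I :: "nat set set"
  assumes "ideal_on_omega I"
    and "borel_family I"
    and "adds_no_reals (quotient_conds I) (quotient_le I)"
  shows "adds_dominating_real (mathias_conds (positive_sets I)) mathias_le"
proof (rule mathias_adds_dominating_real[OF assms(1)])
  fix A assume A: "A \<notin> I"
  obtain R where R: "I = odds ` R" "\<And>z. (\<And>l. \<exists>z'\<in>R. \<forall>i<l. z' i = z i) \<Longrightarrow> z \<in> R"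
    using borel_family_odds[OF assms(2)] by blast
  \<comment> \<open>\<open>B\<close> forces \<open>D\<close> to witness that the generic ultrafilter is not a P-point.\<close>
  define bad where "bad B D \<longleftrightarrow> (\<forall>n. B - D n \<in> I) \<and>
      (\<forall>C\<subseteq>B. (\<forall>n. finite (C - D n)) \<longrightarrow> C \<in> I)" for B and D :: "nat \<Rightarrow> nat set"
  show "\<exists>B X. B \<subseteq> A \<and> B \<notin> I \<and> dominating_family I B X"
  proof (cases "\<exists>B D. B \<subseteq> A \<and> B \<notin> I \<and> bad B D")
    case True
    then obtain B D where "B \<subseteq> A" "B \<notin> I" and "bad B D" by blast
    moreover from this have D: "\<And>n. B - D n \<in> I"
      "\<And>C. C \<subseteq> B \<Longrightarrow> (\<And>n. finite (C - D n)) \<Longrightarrow> C \<in> I"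
      unfolding bad_def by blast+
    moreover have "\<exists>X. dominating_family I B X"
      by (rule dominating_family_non_p_point[OF assms(1) D])
    ultimately show ?thesis by blast
  next
    case False
    \<comment> \<open>Without a bad pair below \<open>A\<close>, every sequence of sets almost
      containing a positive \<open>B \<subseteq> A\<close> has a positive pseudo-intersection inside
      \<open>B\<close>: \<open>A\<close> forces a P-point.\<close>
    have "\<exists>B\<subseteq>A. B \<notin> I \<and> sigma_bounded I I B"
    proof (rule ideal_somewhere_sigma_bounded[OF assms(1,3) R(2) R(1) A])
      fix B and D :: "nat \<Rightarrow> nat set"
      assume B: "B \<subseteq> A" "B \<notin> I" "\<And>n. B - D n \<in> I"
      then have "\<not> bad B D" using False by blast
      then show "\<exists>C\<subseteq>B. C \<notin> I \<and> (\<forall>n. finite (C - D n))" using B(3) unfolding bad_def by blast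
    qed
    then obtain B and F :: "nat \<Rightarrow> nat set set" where B: "B \<subseteq> A" "B \<notin> I"
      and F: "\<And>n. compact_family (F n) \<inter> Pow B \<subseteq> I" "I \<subseteq> (\<Union>n. compact_family (F n))"
      unfolding sigma_bounded_def by blast
    have "\<exists>X. dominating_family I B X"
      by (rule dominating_family_F_sigma[OF assms(1), of F]) (use F in blast)+
    then show ?thesis using B by blast
  qed
qed

end
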